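(* Let $t \geq 2$ be an even integer and let $G$ be a $2$-connected $2t$-regular graph. Let $\mathcal{O}$ be a set of pairwise edge-disjoint odd cycles of $G$. Then there exists a $t$-factor $F$ of $G$ such that for every $O \in \mathcal{O}$ both $E(O) \cap E(F) \neq \emptyset$ and $E(O) \cap (E(G) \setminus E(F)) \neq \emptyset$.
   Context: All graphs are finite and loopless but may have parallel edges. A cycle is a connected $2$-regular subgraph (so two parallel edges form a cycle of length 2); a cycle is odd if it has an odd number of edges. A $t$-factor of $G$ is a spanning $t$-regular subgraph. $2$-connected means connected with no cut-vertex. *)

theory Defs
  imports Main
begin

text \<open>Finite loopless multigraphs: vertex set V, edge set E (edges are abstract
  objects, so parallel edges are allowed), and an endpoint map ends with
  exactly two distinct endpoints per edge.\<close>

definition multigraph :: "'v set \<Rightarrow> 'e set \<Rightarrow> ('e \<Rightarrow> 'v set) \<Rightarrow> bool" where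
  "multigraph V E ends \<longleftrightarrow> finite V \<and> finite E \<and>
     (\<forall>e\<in>E. ends e \<subseteq> V \<and> card (ends e) = 2)"

definition deg :: "('e \<Rightarrow> 'v set) \<Rightarrow> 'e set \<Rightarrow> 'v \<Rightarrow> nat" where
  "deg ends D v = card {e\<in>D. v \<in> ends e}"

definition adj :: "('e \<Rightarrow> 'v set) \<Rightarrow> 'e set \<Rightarrow> 'v \<Rightarrow> 'v \<Rightarrow> bool" where
  "adj ends D u v \<longleftrightarrow> (\<exists>e\<in>D. ends e = {u, v})"

definition connected_sg :: "('e \<Rightarrow> 'v set) \<Rightarrow> 'v set \<Rightarrow> 'e set \<Rightarrow> bool" where
  "connected_sg ends W D \<longleftrightarrow> W \<noteq> {} \<and>
     (\<forall>x\<in>W. \<forall>y\<in>W. (\<lambda>u v. u \<in> W \<and> v \<in> W \<and> adj ends D u v)\<^sup>*\<^sup>* x y)"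

definition two_connected :: "'v set \<Rightarrow> 'e set \<Rightarrow> ('e \<Rightarrow> 'v set) \<Rightarrow> bool" where
  "two_connected V E ends \<longleftrightarrow> connected_sg ends V E \<and>
     (\<forall>v\<in>V. V - {v} \<noteq> {} \<longrightarrow> connected_sg ends (V - {v}) {e\<in>E. v \<notin> ends e})"

definition is_cycle :: "'e set \<Rightarrow> ('e \<Rightarrow> 'v set) \<Rightarrow> 'e set \<Rightarrow> bool" where
  "is_cycle E ends C \<longleftrightarrow> C \<subseteq> E \<and> C \<noteq> {} \<and>
     (\<forall>v\<in>\<Union>(ends ` C). deg ends C v = 2) \<and>
     connected_sg ends (\<Union>(ends ` C)) C"

definition t_factor :: "nat \<Rightarrow> 'v set \<Rightarrow> 'e set \<Rightarrow> ('e \<Rightarrow> 'v set) \<Rightarrow> 'e set \<Rightarrow> bool" where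
  "t_factor t V E ends F \<longleftrightarrow> F \<subseteq> E \<and> (\<forall>v\<in>V. deg ends F v = t)"

end

(* Split every cycle C of the family at some of its vertices v: the two edges of C at v are
   detached from v and meet at a new vertex of degree 2.  If every component of the resulting
   graph has an even number of edges, then colouring Eulerian trails alternately gives
   every vertex equally many edges of both colours, and the two edges at a split are coloured
   differently.  To choose the splits, replace every cycle C by a star joining a new vertex to all
   vertices of C.  By 2-connectedness, and since 2t > 2, this star graph is bridgeless, so
   by a theorem of Fleischner it has a subgraph with all degrees even that covers
   every vertex of degree at least 3, in particular every star centre.  Splitting C at v whenever
   the edge Cv lies in this subgraph makes all components even, since t is even.

   Graphs are given by a set of edges together with a function h that maps every dart, that is,
   every pair of an edge and one of its two sides, to a vertex; so loops are allowed. *)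

theory Submission
  imports Defs
begin

text \<open>Which splits make all components even? A component with n edges has degree sum 2n. Each
  split at v takes 2 from the degree of v and creates a vertex of degree 2. Modulo 2, n is therefore
  t times the number of original vertices in the component plus the number of splits (C, v) for
  which exactly one of the rest of v and the new vertex lies in it. A cycle stays connected when it
  is detached, so all its split vertices lie in one component and C acts as a single vertex: the
  second term counts rays in a cut of the star graph. It is even as soon as the chosen rays come
  from a subgraph with all degrees even. Covering the centre of C means that C is split at least
  once; the centre has degree at least 3 because an odd cycle without loops has at least 3 vertices.

  The covering theorem is proved by induction with one prescribed edge in the subgraph. Splitting or
  contracting lets some vertex drop out of the list of vertices to be covered, and the prescribed
  edge is what keeps that vertex covered.\<close>

section \<open>Dart graphs: degrees, cuts and contraction\<close>

definition dg :: "('e \<times> bool \<Rightarrow> 'v) \<Rightarrow> 'e set \<Rightarrow> 'v \<Rightarrow> nat" where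
  "dg h F v = card {d. fst d \<in> F \<and> h d = v}"

definition crossing :: "('e \<times> bool \<Rightarrow> 'v) \<Rightarrow> 'e set \<Rightarrow> 'v set \<Rightarrow> 'e set" where
  "crossing h F X = {e\<in>F. (h (e, True) \<in> X) \<noteq> (h (e, False) \<in> X)}"

text \<open>A bridge appears as a one-edge cut of some vertex set, so disconnected graphs are
  allowed and components never have to be named.\<close>

definition bridgeless :: "('e \<times> bool \<Rightarrow> 'v) \<Rightarrow> 'e set \<Rightarrow> bool" where
  "bridgeless h E \<longleftrightarrow> (\<forall>X. card (crossing h E X) \<noteq> 1)"

definition merge :: "'v \<Rightarrow> 'v \<Rightarrow> ('e \<times> bool \<Rightarrow> 'v) \<Rightarrow> 'e \<times> bool \<Rightarrow> 'v" where
  "merge a b h d = (if h d = b then a else h d)"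

definition flip :: "'e \<times> bool \<Rightarrow> 'e \<times> bool" where
  "flip d = (fst d, \<not> snd d)"

lemma fst_flip [simp]: "fst (flip d) = fst d"
  by (simp add: flip_def)

lemma flip_flip [simp]: "flip (flip d) = d"
  by (simp add: flip_def)

lemma flip_neq [simp]: "flip d \<noteq> d" "d \<noteq> flip d"
  by (auto simp: flip_def prod_eq_iff)

lemma same_edge_cases: "fst d = fst d' \<longleftrightarrow> d = d' \<or> d = flip d'"
  by (auto simp: flip_def prod_eq_iff)

lemma crossing_iff_dart: "fst d \<in> crossing h E X \<longleftrightarrow> fst d \<in> E \<and> (h d \<in> X) \<noteq> (h (flip d) \<in> X)"
  by (cases d; cases "snd d") (auto simp: crossing_def flip_def)

lemma crossing_subset: "crossing h E X \<subseteq> E"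
  by (auto simp: crossing_def)

lemma finite_crossing [simp]: "finite E \<Longrightarrow> finite (crossing h E X)"
  by (meson crossing_subset finite_subset)

lemma crossing_Compl [simp]: "crossing h E (- X) = crossing h E X"
  by (auto simp: crossing_def)

lemma finite_darts [simp]: "finite F \<Longrightarrow> finite {d :: 'e \<times> bool. fst d \<in> F \<and> P d}"
  by (rule finite_subset[of _ "F \<times> UNIV"]) auto

lemma card_darts:
  assumes "finite F"
  shows "card {d :: 'e \<times> bool. fst d \<in> F \<and> P d}
    = (\<Sum>e\<in>F. of_bool (P (e, True)) + of_bool (P (e, False)))"
proof -
  have "{d. fst d \<in> F \<and> P d}
      = (\<lambda>e. (e, True)) ` {e\<in>F. P (e, True)} \<union> (\<lambda>e. (e, False)) ` {e\<in>F. P (e, False)}"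
    by (auto simp: image_iff) (metis (full_types))+
  moreover have "card ((\<lambda>e. (e, True)) ` {e\<in>F. P (e, True)} \<union> (\<lambda>e. (e, False)) ` {e\<in>F. P (e, False)})
      = card {e\<in>F. P (e, True)} + card {e\<in>F. P (e, False)}"
    using assms by (subst card_Un_disjoint) (auto simp: card_image inj_on_def)
  ultimately show ?thesis
    using assms by (simp add: sum.distrib sum.If_cases of_bool_def Int_def)
qed

lemma dg_sum:
  "finite F \<Longrightarrow> dg h F v = (\<Sum>e\<in>F. of_bool (h (e, True) = v) + of_bool (h (e, False) = v))"
  unfolding dg_def by (rule card_darts)

lemma card_crossing_sum:
  "finite E \<Longrightarrow> card (crossing h E X) = (\<Sum>e\<in>E. of_bool ((h (e, True) \<in> X) \<noteq> (h (e, False) \<in> X)))"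
  unfolding crossing_def by (simp add: sum.If_cases of_bool_def Int_def)

lemma dg_insert:
  assumes "finite F" "fst d \<notin> F"
  shows "dg h (insert (fst d) F) x = dg h F x + of_bool (h d = x) + of_bool (h (flip d) = x)"
  using assms by (cases d; cases "snd d") (auto simp: dg_sum flip_def)

lemma dg_remove:
  assumes "finite E" "fst d \<in> E"
  shows "dg h E x = dg h (E - {fst d}) x + of_bool (h d = x) + of_bool (h (flip d) = x)"
  using dg_insert[of "E - {fst d}" d h x] assms by (simp add: insert_absorb)

lemma dg_pos:
  assumes "finite F" "fst d \<in> F" "h d = v"
  shows "dg h F v \<noteq> 0"
  using assms by (auto simp: dg_def) (metis prod.collapse)

lemma dg_merge:
  assumes "finite F" "a \<noteq> b"
  shows "dg (merge a b h) F x
    = (if x = a then dg h F a + dg h F b else if x = b then 0 else dg h F x)"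
proof -
  have "dg (merge a b h) F a = dg h F a + dg h F b"
    unfolding dg_sum[OF assms(1)] sum.distrib[symmetric]
    by (rule sum.cong) (use assms in \<open>auto simp: merge_def\<close>)
  then show ?thesis
    using assms(2) by (auto simp: dg_def merge_def intro!: arg_cong[where f = card])
qed

lemma card_darts_into:
  assumes "finite F" "finite A" "\<And>d. fst d \<in> F \<Longrightarrow> h d \<in> A"
  shows "card {d. fst d \<in> F \<and> h d \<in> X} = (\<Sum>x\<in>A \<inter> X. dg h F x)"
proof -
  have "{d. fst d \<in> F \<and> h d \<in> X} = (\<Union>x\<in>A \<inter> X. {d. fst d \<in> F \<and> h d = x})"
    using assms(3) by auto
  also have "card \<dots> = (\<Sum>x\<in>A \<inter> X. dg h F x)"
    unfolding dg_def by (rule card_UN_disjoint) (use assms in auto)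
  finally show ?thesis .
qed

lemma darts_in_set:
  assumes "finite E"
  shows "card {d. fst d \<in> E \<and> h d \<in> X}
    = 2 * card {e\<in>E. h (e, True) \<in> X \<and> h (e, False) \<in> X} + card (crossing h E X)"
proof -
  have *: "card {e\<in>E. h (e, True) \<in> X \<and> h (e, False) \<in> X}
      = (\<Sum>e\<in>E. of_bool (h (e, True) \<in> X \<and> h (e, False) \<in> X))"
    using assms by (simp add: sum.If_cases of_bool_def Int_def)
  show ?thesis
    unfolding card_darts[OF assms] * card_crossing_sum[OF assms] sum_distrib_left sum.distrib[symmetric]
    by (rule sum.cong) auto
qed

lemma even_crossing:
  assumes "finite E" "\<And>v. even (dg h E v)"
  shows "even (card (crossing h E X))"
proof -
  have "card {d. fst d \<in> E \<and> h d \<in> X} = (\<Sum>x\<in>h ` (E \<times> UNIV) \<inter> X. dg h E x)"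
    by (rule card_darts_into) (use assms in \<open>auto intro!: imageI simp: mem_Times_iff\<close>)
  then have "even (card {d. fst d \<in> E \<and> h d \<in> X})"
    using assms(2) by (simp add: dvd_sum)
  then show ?thesis
    using darts_in_set[OF assms(1), of h X] by simp
qed

lemma bridgeless_if_even: "finite E \<Longrightarrow> (\<And>v. even (dg h E v)) \<Longrightarrow> bridgeless h E"
  unfolding bridgeless_def by (metis even_crossing odd_one)

lemma bridgelessD: "bridgeless h E \<Longrightarrow> crossing h E X \<noteq> {k}"
  by (auto simp: bridgeless_def dest: spec[of _ X])

text \<open>The cuts of the contracted graph are the old cuts that do not separate \<open>u\<close>
  from \<open>v\<close>; hence contraction creates no bridge.\<close>

lemma crossing_merge:
  assumes "h d = u" "h (flip d) = v" "u \<noteq> v"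
  shows "crossing (merge u v h) (E - {fst d}) X = crossing h E (if u \<in> X then insert v X else X - {v})"
    (is "_ = crossing h E ?X")
proof -
  have "merge u v h d' \<in> X \<longleftrightarrow> h d' \<in> ?X" for d'
    using assms(3) by (auto simp: merge_def)
  moreover have "fst d \<notin> crossing h E ?X"
    using assms by (auto simp: crossing_iff_dart)
  ultimately show ?thesis
    by (auto simp: crossing_def)
qed

lemma bridgeless_merge:
  assumes "bridgeless h E" "h d = u" "h (flip d) = v" "u \<noteq> v"
  shows "bridgeless (merge u v h) (E - {fst d})"
  using assms crossing_merge[OF assms(2-4)] unfolding bridgeless_def by metis

section \<open>Uncrossing two cuts, and splitting off two darts without creating a bridge\<close>

definition between :: "('e \<times> bool \<Rightarrow> 'v) \<Rightarrow> 'e set \<Rightarrow> 'v set \<Rightarrow> 'v set \<Rightarrow> 'e set" where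
  "between h E P Q = {e\<in>E. h (e, True) \<in> P \<and> h (e, False) \<in> Q \<or> h (e, False) \<in> P \<and> h (e, True) \<in> Q}"

lemma betweenI: "fst d \<in> E \<Longrightarrow> h d \<in> Q \<Longrightarrow> h (flip d) \<in> P \<Longrightarrow> fst d \<in> between h E P Q"
  by (cases d; cases "snd d") (auto simp: between_def flip_def)

lemma finite_between [simp]: "finite E \<Longrightarrow> finite (between h E P Q)"
  by (simp add: between_def)

text \<open>Posimodularity and submodularity of the crossing function, with all the slack terms.\<close>

lemma crossing_cells:
  fixes h :: "'e \<times> bool \<Rightarrow> 'v" and X Y :: "'v set"
  assumes "finite E"
  defines "n \<equiv> \<lambda>P Q. card (between h E P Q)"
  defines "A \<equiv> X \<inter> Y" and "B \<equiv> X - Y" and "C \<equiv> Y - X" and "D \<equiv> - (X \<union> Y)"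
  shows "card (crossing h E X) = n A C + n A D + n B C + n B D"
    and "card (crossing h E Y) = n A B + n A D + n B C + n C D"
    and "card (crossing h E A) = n A B + n A C + n A D"
    and "card (crossing h E B) = n A B + n B C + n B D"
    and "card (crossing h E C) = n A C + n B C + n C D"
    and "card (crossing h E (X \<union> Y)) = n A D + n B D + n C D"
proof -
  have n: "n P Q = (\<Sum>e\<in>E. of_bool (h (e, True) \<in> P \<and> h (e, False) \<in> Q
    \<or> h (e, False) \<in> P \<and> h (e, True) \<in> Q))" for P Q
    unfolding n_def between_def using assms(1) by (simp add: sum.If_cases of_bool_def Int_def)
  note unf = n card_crossing_sum[OF assms(1)] sum.distrib[symmetric] A_def B_def C_def D_def
  show "card (crossing h E X) = n A C + n A D + n B C + n B D"
    unfolding unf by (rule sum.cong[OF refl], rename_tac e, case_tac "h (e, True) \<in> X"; case_tac "h (e, False) \<in> X"; case_tac "h (e, True) \<in> Y"; case_tac "h (e, False) \<in> Y"; simp)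
  show "card (crossing h E Y) = n A B + n A D + n B C + n C D"
    unfolding unf by (rule sum.cong[OF refl], rename_tac e, case_tac "h (e, True) \<in> X"; case_tac "h (e, False) \<in> X"; case_tac "h (e, True) \<in> Y"; case_tac "h (e, False) \<in> Y"; simp)
  show "card (crossing h E A) = n A B + n A C + n A D"
    unfolding unf by (rule sum.cong[OF refl], rename_tac e, case_tac "h (e, True) \<in> X"; case_tac "h (e, False) \<in> X"; case_tac "h (e, True) \<in> Y"; case_tac "h (e, False) \<in> Y"; simp)
  show "card (crossing h E B) = n A B + n B C + n B D"
    unfolding unf by (rule sum.cong[OF refl], rename_tac e, case_tac "h (e, True) \<in> X"; case_tac "h (e, False) \<in> X"; case_tac "h (e, True) \<in> Y"; case_tac "h (e, False) \<in> Y"; simp)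
  show "card (crossing h E C) = n A C + n B C + n C D"
    unfolding unf by (rule sum.cong[OF refl], rename_tac e, case_tac "h (e, True) \<in> X"; case_tac "h (e, False) \<in> X"; case_tac "h (e, True) \<in> Y"; case_tac "h (e, False) \<in> Y"; simp)
  show "card (crossing h E (X \<union> Y)) = n A D + n B D + n C D"
    unfolding unf by (rule sum.cong[OF refl], rename_tac e, case_tac "h (e, True) \<in> X"; case_tac "h (e, False) \<in> X"; case_tac "h (e, True) \<in> Y"; case_tac "h (e, False) \<in> Y"; simp)
qed

lemma card_pos: "finite A \<Longrightarrow> x \<in> A \<Longrightarrow> 1 \<le> card A"
  by (metis One_nat_def Suc_leI card_gt_0_iff empty_iff)

text \<open>The two darts meet at \<open>z\<close>, meant to be a fresh vertex of degree 2, instead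
  of being replaced by one edge. The edge set stays the same, so a subgraph of the split graph is
  also a subgraph of the old one.\<close>

definition split_off :: "'e \<times> bool \<Rightarrow> 'e \<times> bool \<Rightarrow> 'v \<Rightarrow> ('e \<times> bool \<Rightarrow> 'v) \<Rightarrow> 'e \<times> bool \<Rightarrow> 'v" where
  "split_off p q z h = h(p := z, q := z)"

lemma dg_split_off:
  assumes "finite F" "\<And>d. fst d \<in> F \<Longrightarrow> h d \<noteq> z" "h p = w" "h q = w" "z \<noteq> w"
  shows "dg h F x = (if x = w then dg (split_off p q z h) F w + dg (split_off p q z h) F z
    else if x = z then 0 else dg (split_off p q z h) F x)"
proof -
  have "merge w z (split_off p q z h) d = h d" if "fst d \<in> F" for d
    using assms(2)[OF that] assms(3-5) by (auto simp: merge_def split_off_def)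
  then have "dg h F x = dg (merge w z (split_off p q z h)) F x"
    unfolding dg_def by (metis (mono_tags, lifting))
  then show ?thesis
    using dg_merge[OF assms(1), of w z "split_off p q z h" x] assms(5) by simp
qed

lemma crossing_split_off_same:
  assumes "h p = w" "h q = w" "w \<in> X \<longleftrightarrow> z \<in> X"
  shows "crossing (split_off p q z h) E X = crossing h E X"
  using assms by (auto simp: crossing_def split_off_def)

text \<open>Undoing the split moves exactly the darts \<open>p\<close> and \<open>q\<close> out of
  \<open>X\<close>, which toggles whether their edges cross. If both are darts of one edge, the two
  changes cancel.\<close>

lemma crossing_split_off:
  assumes "h p = w" "h q = w" "p \<noteq> q" "z \<in> X" "w \<notin> X" "\<And>d. fst d \<in> E \<Longrightarrow> h d \<noteq> z" "k \<in> E"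
  shows "k \<in> crossing h E (X - {z}) \<longleftrightarrow>
    (k \<in> crossing (split_off p q z h) E X) \<noteq> (fst p \<noteq> fst q \<and> (k = fst p \<or> k = fst q))"
proof -
  have *: "h d \<in> X - {z} \<longleftrightarrow> (split_off p q z h d \<in> X) \<noteq> (d = p \<or> d = q)" if "fst d \<in> E" for d
    using assms(1-5) assms(6)[OF that] by (auto simp: split_off_def)
  have "k \<in> crossing h E (X - {z}) \<longleftrightarrow> (k \<in> crossing (split_off p q z h) E X) \<noteq>
      (((k, True) = p \<or> (k, True) = q) \<noteq> ((k, False) = p \<or> (k, False) = q))"
    using assms(7) *[of "(k, True)"] *[of "(k, False)"] by (auto simp: crossing_def)
  then show ?thesis
    using assms(3) by (cases p; cases q) auto
qed

lemma split_off_bridge: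
  assumes "bridgeless h E" "finite E" "h p = w" "h q = w" "p \<noteq> q" "fst p \<in> E" "fst q \<in> E"
    and fresh: "\<And>d. fst d \<in> E \<Longrightarrow> h d \<noteq> z"
    and "\<not> bridgeless (split_off p q z h) E"
  obtains X where "w \<notin> X" "fst p \<noteq> fst q" "fst p \<in> crossing h E X" "fst q \<in> crossing h E X"
    "card (crossing h E X) = 3"
proof -
  let ?h = "split_off p q z h"
  obtain X0 where "card (crossing ?h E X0) = 1"
    using assms(9) unfolding bridgeless_def by blast
  \<comment> \<open>A set and its complement have the same crossing edges, so \<open>w\<close> may
    be assumed outside.\<close>
  then have "\<exists>X. card (crossing ?h E X) = 1 \<and> w \<notin> X"
    by (cases "w \<in> X0"; intro exI[of _ "if w \<in> X0 then - X0 else X0"]) auto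
  then obtain X where X: "card (crossing ?h E X) = 1" "w \<notin> X"
    by blast
  \<comment> \<open>With \<open>z\<close> and \<open>w\<close> on the same side, the one-edge cut
    would exist before the split.\<close>
  have zX: "z \<in> X"
    using X crossing_split_off_same[OF assms(3,4), of X z E] assms(1) unfolding bridgeless_def by metis
  obtain x where x: "crossing ?h E X = {x}"
    using X(1) card_1_singletonE by blast
  have xE: "x \<in> E"
    using crossing_subset[of ?h E X] x by simp
  have iff: "k \<in> crossing h E (X - {z}) \<longleftrightarrow> (k = x) \<noteq> (fst p \<noteq> fst q \<and> (k = fst p \<or> k = fst q))"
    if "k \<in> E" for k
    using crossing_split_off[OF assms(3-5) zX X(2) fresh that] x by simp
  have no1: "crossing h E (X - {z}) \<noteq> {k}" for k
    using assms(1) by (rule bridgelessD)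
  have eq: "crossing h E (X - {z}) = {k\<in>E. (k = x) \<noteq> (fst p \<noteq> fst q \<and> (k = fst p \<or> k = fst q))}"
  proof (intro set_eqI iffI)
    fix k assume "k \<in> crossing h E (X - {z})"
    then show "k \<in> {k\<in>E. (k = x) \<noteq> (fst p \<noteq> fst q \<and> (k = fst p \<or> k = fst q))}"
      using iff[of k] subsetD[OF crossing_subset, of k h E "X - {z}"] by simp
  next
    fix k assume "k \<in> {k\<in>E. (k = x) \<noteq> (fst p \<noteq> fst q \<and> (k = fst p \<or> k = fst q))}"
    then show "k \<in> crossing h E (X - {z})"
      using iff[of k] by simp
  qed
  have ne: "fst p \<noteq> fst q"
  proof
    assume "fst p = fst q"
    then have "crossing h E (X - {z}) = {x}"
      using xE by (auto simp: eq)
    then show False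
      using no1 by blast
  qed
  have "x \<noteq> fst p"
  proof
    assume "x = fst p"
    then have "crossing h E (X - {z}) = {fst q}"
      using ne assms(7) by (auto simp: eq)
    then show False
      using no1 by blast
  qed
  moreover have "x \<noteq> fst q"
  proof
    assume "x = fst q"
    then have "crossing h E (X - {z}) = {fst p}"
      using ne assms(6) by (auto simp: eq)
    then show False
      using no1 by blast
  qed
  ultimately have "crossing h E (X - {z}) = {x, fst p, fst q}" "card {x, fst p, fst q} = 3"
    using ne xE assms(6,7) by (auto simp: eq)
  then show thesis
    using that[of "X - {z}"] X(2) ne by simp
qed

text \<open>Each failing split gives a 3-edge cut through its two darts. If neither cut contains all
  three edges, uncrossing shows that their union is such a cut.\<close>

lemma two_split_off_bridges:
  assumes "bridgeless h E" "finite E" "h p = w" "h q = w" "h r = w"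
    and "p \<noteq> q" "p \<noteq> r" "q \<noteq> r" "fst p \<in> E" "fst q \<in> E" "fst r \<in> E"
    and fresh: "\<And>d. fst d \<in> E \<Longrightarrow> h d \<noteq> z"
    and "\<not> bridgeless (split_off p q z h) E" "\<not> bridgeless (split_off p r z h) E"
  obtains Z where "w \<notin> Z" "crossing h E Z = {fst p, fst q, fst r}" "card {fst p, fst q, fst r} = 3"
proof -
  obtain X where X: "w \<notin> X" "fst p \<noteq> fst q" "fst p \<in> crossing h E X" "fst q \<in> crossing h E X"
    "card (crossing h E X) = 3"
    using split_off_bridge[OF assms(1-4,6,9,10) fresh assms(13)] by metis
  obtain Y where Y: "w \<notin> Y" "fst p \<noteq> fst r" "fst p \<in> crossing h E Y" "fst r \<in> crossing h E Y"
    "card (crossing h E Y) = 3"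
    using split_off_bridge[OF assms(1-3,5,7,9,11) fresh assms(14)] by metis
  have qr: "fst q \<noteq> fst r"
    using X(1,4) assms(4,5,8) by (auto simp: same_edge_cases crossing_iff_dart)
  have c3: "card {fst p, fst q, fst r} = 3"
    using X(2) Y(2) qr by simp
  have "\<exists>Z. w \<notin> Z \<and> {fst p, fst q, fst r} \<subseteq> crossing h E Z \<and> card (crossing h E Z) = 3"
  proof (cases "fst q \<in> crossing h E Y \<or> fst r \<in> crossing h E X")
    case True
    then show ?thesis
      using X Y by blast
  next
    case False
    have fl: "h (flip p) \<in> X \<inter> Y" "h (flip q) \<in> X - Y" "h (flip r) \<in> Y - X"
      using False X Y assms(3-5,9-11) by (auto simp: crossing_iff_dart)
    note cells = crossing_cells[OF assms(2), where h = h and X = X and Y = Y]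
    have btw: "fst p \<in> between h E (X \<inter> Y) (- (X \<union> Y))" "fst q \<in> between h E (X - Y) (- (X \<union> Y))"
      "fst r \<in> between h E (Y - X) (- (X \<union> Y))"
      using fl X(1) Y(1) assms(3-5,9-11) by (auto intro!: betweenI)
    have "1 \<le> card (between h E (X \<inter> Y) (- (X \<union> Y)))" "1 \<le> card (between h E (X - Y) (- (X \<union> Y)))"
      "1 \<le> card (between h E (Y - X) (- (X \<union> Y)))"
      by (rule card_pos[OF finite_between[OF assms(2)] btw(1)],
          rule card_pos[OF finite_between[OF assms(2)] btw(2)],
          rule card_pos[OF finite_between[OF assms(2)] btw(3)])
    moreover have "card (crossing h E (X \<inter> Y)) \<noteq> 1" "card (crossing h E (X - Y)) \<noteq> 1" "card (crossing h E (Y - X)) \<noteq> 1"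
      using assms(1) by (auto simp: bridgeless_def)
    \<comment> \<open>Posimodularity: the two cuts of size 3 add up to the cuts of
      \<open>X - Y\<close> and \<open>Y - X\<close> plus twice the edges from
      \<open>X \<inter> Y\<close> to the outside. The differences have cuts of size at least 2 and
      \<open>fst p\<close> counts in the last term, so 6 = 2 + 2 + 2 is tight.\<close>
    moreover from calculation have AD: "card (between h E (X \<inter> Y) (- (X \<union> Y))) = 1"
      using cells X(5) Y(5) by linarith
    moreover from calculation have B: "card (crossing h E (X - Y)) = 2" "card (crossing h E (Y - X)) = 2"
      using cells X(5) Y(5) by linarith+
    \<comment> \<open>With value 2, no edge would join \<open>X \<inter> Y\<close> to either
      difference, leaving \<open>X \<inter> Y\<close> with a one-edge cut.\<close>
    moreover from calculation have "card (between h E (X - Y) (- (X \<union> Y))) \<noteq> 2"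
      using cells X(5) Y(5) by linarith
    ultimately have "card (crossing h E (X \<union> Y)) = 3"
      using cells X(5) Y(5) by linarith
    moreover have "{fst p, fst q, fst r} \<subseteq> crossing h E (X \<union> Y)"
      using fl X(1) Y(1) assms(3-5,9-11) by (auto simp: crossing_iff_dart)
    ultimately show ?thesis
      using X(1) Y(1) by blast
  qed
  then obtain Z where Z: "w \<notin> Z" "{fst p, fst q, fst r} \<subseteq> crossing h E Z" "card (crossing h E Z) = 3"
    by blast
  then have "crossing h E Z = {fst p, fst q, fst r}"
    using card_subset_eq[OF finite_crossing[OF assms(2)] Z(2)] c3 by simp
  then show thesis
    using that Z(1) c3 by blast
qed

text \<open>At degree 4 two candidates suffice: if both fail, three of the four darts at
  \<open>w\<close> lead into a set \<open>Z\<close> whose cut is just their edges, and adding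
  \<open>w\<close> to \<open>Z\<close> leaves the edge of \<open>s\<close> as a bridge.\<close>

lemma split_off_bridgeless_degree4:
  assumes "bridgeless h E" "finite E" "{d. fst d \<in> E \<and> h d = w} = {p, q, r, s}" "distinct [p, q, r, s]"
    and fresh: "\<And>d. fst d \<in> E \<Longrightarrow> h d \<noteq> z"
  shows "bridgeless (split_off p q z h) E \<or> bridgeless (split_off p r z h) E"
proof (rule ccontr)
  assume contra: "\<not> ?thesis"
  have at: "fst d \<in> E \<and> h d = w \<longleftrightarrow> d = p \<or> d = q \<or> d = r \<or> d = s" for d
    using assms(3) by blast
  have "fst p \<in> E" "h p = w" "fst q \<in> E" "h q = w" "fst r \<in> E" "h r = w" and s: "fst s \<in> E" "h s = w"
    using at by metis+
  then obtain Z where Z: "w \<notin> Z" "crossing h E Z = {fst p, fst q, fst r}"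
    using two_split_off_bridges[OF assms(1,2) _ _ _ _ _ _ _ _ _ fresh, of p w q r] contra assms(4)
    by auto
  have inZ: "h (flip d) \<in> Z" if "d = p \<or> d = q \<or> d = r" for d
    using that Z at[of d] crossing_iff_dart[of d h E Z] by auto
  have sZ: "fst s \<notin> crossing h E Z"
  proof
    assume "fst s \<in> crossing h E Z"
    then obtain d where d: "d = p \<or> d = q \<or> d = r" "fst s = fst d"
      using Z(2) by blast
    then have "s = flip d"
      using assms(4) by (auto simp: same_edge_cases)
    then show False
      using inZ[OF d(1)] s(2) Z(1) by simp
  qed
  have ns: "h (flip s) \<notin> insert w Z"
  proof -
    have "h (flip s) \<notin> Z"
      using sZ s Z(1) by (simp add: crossing_iff_dart)
    moreover have "h (flip s) \<noteq> w"
      using at[of "flip s"] s inZ[of "flip s"] Z(1) by auto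
    ultimately show ?thesis
      by simp
  qed
  have *: "fst d = fst s" if "fst d \<in> crossing h E (insert w Z)" "h d = w" for d :: "'a \<times> bool"
    using that at[of d] inZ[of d] by (auto simp: crossing_iff_dart)
  have only: "fst d = fst s" if d: "fst d \<in> crossing h E (insert w Z)" for d :: "'a \<times> bool"
  proof (cases "h d = w \<or> h (flip d) = w")
    case True
    then show ?thesis
      using *[of d] *[of "flip d"] d by auto
  next
    case False
    then have "fst d \<in> crossing h E Z"
      using d by (auto simp: crossing_iff_dart)
    then obtain d' where "d' = p \<or> d' = q \<or> d' = r" "fst d = fst d'"
      using Z(2) by blast
    then show ?thesis
      using False at[of d'] by (auto simp: same_edge_cases)
  qed
  have "fst s \<in> crossing h E (insert w Z)"
    using s ns by (simp add: crossing_iff_dart)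
  moreover have "k = fst s" if "k \<in> crossing h E (insert w Z)" for k
    using only[of "(k, True)"] that by simp
  ultimately have "crossing h E (insert w Z) = {fst s}"
    by blast
  then show False
    using bridgelessD[OF assms(1)] by blast
qed

text \<open>Without a degree bound three candidates are needed. If all fail, \<open>p\<close>,
  \<open>q\<close>, \<open>r\<close> and \<open>p\<close>, \<open>q\<close>, \<open>s\<close> give
  two 3-edge cuts that share two edges. Posimodularity would then require 6 to be at least 2 + 2 +
  4.\<close>

lemma split_off_bridgeless_three:
  assumes "bridgeless h E" "finite E" "h p = w" "h q = w" "h r = w" "h s = w"
    and "distinct [p, q, r, s]" "fst p \<in> E" "fst q \<in> E" "fst r \<in> E" "fst s \<in> E"
    and fresh: "\<And>d. fst d \<in> E \<Longrightarrow> h d \<noteq> z"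
  shows "bridgeless (split_off p q z h) E \<or> bridgeless (split_off p r z h) E
    \<or> bridgeless (split_off p s z h) E"
proof (rule ccontr)
  assume contra: "\<not> ?thesis"
  obtain X where X: "w \<notin> X" "crossing h E X = {fst p, fst q, fst r}" "card {fst p, fst q, fst r} = 3"
    using two_split_off_bridges[OF assms(1,2,3,4,5) _ _ _ assms(8,9,10) fresh] assms(7) contra by auto
  obtain Y where Y: "w \<notin> Y" "crossing h E Y = {fst p, fst q, fst s}" "card {fst p, fst q, fst s} = 3"
    using two_split_off_bridges[OF assms(1,2,3,4,6) _ _ _ assms(8,9,11) fresh] assms(7) contra by auto
  have ne: "fst p \<noteq> fst q" "fst p \<noteq> fst r" "fst p \<noteq> fst s" "fst q \<noteq> fst r" "fst q \<noteq> fst s"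
    using X(3) Y(3) by (auto simp: card_insert_if split: if_splits)
  have rs: "fst r \<noteq> fst s"
    using crossing_iff_dart[of r h E X] X assms(5,6,7) by (auto simp: same_edge_cases)
  have fl: "h (flip p) \<in> X \<inter> Y" "h (flip q) \<in> X \<inter> Y" "h (flip r) \<in> X - Y" "h (flip s) \<in> Y - X"
    using crossing_iff_dart[of p h E X] crossing_iff_dart[of p h E Y] crossing_iff_dart[of q h E X] crossing_iff_dart[of q h E Y]
      crossing_iff_dart[of r h E X] crossing_iff_dart[of r h E Y] crossing_iff_dart[of s h E X] crossing_iff_dart[of s h E Y]
      X(1,2) Y(1,2) ne rs assms(3-6,8-11) by simp_all
  have btw: "{fst p, fst q} \<subseteq> between h E (X \<inter> Y) (- (X \<union> Y))" "fst r \<in> between h E (X - Y) (- (X \<union> Y))"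
      "fst s \<in> between h E (Y - X) (- (X \<union> Y))"
    using fl X(1) Y(1) assms(3-6,8-11) by (auto intro!: betweenI)
  have "2 \<le> card (between h E (X \<inter> Y) (- (X \<union> Y)))"
    using card_mono[OF finite_between[OF assms(2)] btw(1)] ne by simp
  moreover have "1 \<le> card (between h E (X - Y) (- (X \<union> Y)))" "1 \<le> card (between h E (Y - X) (- (X \<union> Y)))"
    by (rule card_pos[OF finite_between[OF assms(2)] btw(2)],
        rule card_pos[OF finite_between[OF assms(2)] btw(3)])
  moreover have "card (crossing h E (X - Y)) \<noteq> 1" "card (crossing h E (Y - X)) \<noteq> 1"
    using assms(1) by (auto simp: bridgeless_def)
  moreover have "card (crossing h E X) = 3" "card (crossing h E Y) = 3"
    using X(2,3) Y(2,3) by simp_all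
  ultimately show False
    using crossing_cells(1,2,4,5)[OF assms(2), where h = h and X = X and Y = Y] by linarith
qed

section \<open>Even subgraphs covering all vertices of degree at least 3\<close>

lemma dg_loops:
  "finite E \<Longrightarrow> dg h E u = 2 * card {e\<in>E. h (e, True) = u \<and> h (e, False) = u} + card (crossing h E {u})"
  using darts_in_set[of E h "{u}"] by (simp add: dg_def)

lemma ex_fresh:
  assumes "infinite (UNIV :: 'v set)" "finite E"
  obtains z :: 'v where "\<And>d. fst d \<in> E \<Longrightarrow> h (d :: 'e \<times> bool) \<noteq> z"
proof -
  have "finite (h ` (E \<times> UNIV))"
    using assms(2) by simp
  then obtain z where "z \<notin> h ` (E \<times> UNIV)"
    using ex_new_if_finite[OF assms(1)] by blast
  then show thesis
    using that[of z] by (metis SigmaI UNIV_I image_eqI prod.collapse)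
qed

text \<open>Only vertices carrying a dart count. The induction measure is
  \<open>2 * card E - vcount h E\<close>, a genuine difference by \<open>vcount_le\<close>:
  splitting raises \<open>vcount\<close>, while contracting an edge lowers \<open>2 * card E\<close>
  by 2 and \<open>vcount\<close> by at most 1.\<close>

definition vcount :: "('e \<times> bool \<Rightarrow> 'v) \<Rightarrow> 'e set \<Rightarrow> nat" where
  "vcount h E = card (h ` {d. fst d \<in> E})"

lemma finite_all_darts [simp]: "finite E \<Longrightarrow> finite {d :: 'e \<times> bool. fst d \<in> E}"
  using finite_darts[of E "\<lambda>_. True"] by simp

lemma vcount_le:
  fixes h :: "'e \<times> bool \<Rightarrow> 'v"
  assumes "finite E"
  shows "vcount h E \<le> 2 * card E"
proof -
  have "card {d :: 'e \<times> bool. fst d \<in> E} = 2 * card E"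
    using card_darts[of E "\<lambda>_. True"] assms by simp
  then show ?thesis
    unfolding vcount_def using card_image_le[of "{d. fst d \<in> E}" h] assms by simp
qed

lemma vcount_le_Suc:
  fixes h h' :: "'e \<times> bool \<Rightarrow> 'v"
  assumes "finite E'" "\<And>d. fst d \<in> E \<Longrightarrow> h d \<noteq> y \<Longrightarrow> \<exists>d'. fst d' \<in> E' \<and> h' d' = h d"
  shows "vcount h E \<le> Suc (vcount h' E')"
proof -
  have "h ` {d. fst d \<in> E} \<subseteq> insert y (h' ` {d. fst d \<in> E'})"
  proof
    fix x assume "x \<in> h ` {d. fst d \<in> E}"
    then obtain d where d: "fst d \<in> E" "x = h d"
      by blast
    show "x \<in> insert y (h' ` {d. fst d \<in> E'})"
    proof (cases "h d = y")
      case False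
      then obtain d' where "fst d' \<in> E'" "h' d' = x"
        using assms(2) d by metis
      then show ?thesis
        by (intro insertI2 image_eqI[of _ _ d']) simp_all
    qed (use d in simp)
  qed
  then have "vcount h E \<le> card (insert y (h' ` {d. fst d \<in> E'}))"
    unfolding vcount_def using assms(1) by (intro card_mono) simp_all
  also have "\<dots> \<le> Suc (vcount h' E')"
    unfolding vcount_def using assms(1) by (simp add: card_insert_if)
  finally show ?thesis .
qed

text \<open>The third dart \<open>r\<close> keeps \<open>w\<close> in the count, so the fresh vertex
  is a real gain.\<close>

lemma vcount_split_off:
  fixes h :: "'e \<times> bool \<Rightarrow> 'v"
  assumes "finite E" "\<And>d. fst d \<in> E \<Longrightarrow> h d \<noteq> z" "h p = w" "h q = w" "fst p \<in> E"
    and "fst r \<in> E" "h r = w" "r \<noteq> p" "r \<noteq> q"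
  shows "vcount h E < vcount (split_off p q z h) E"
proof -
  have "split_off p q z h p = z"
    by (simp add: split_off_def)
  then have "z \<in> split_off p q z h ` {d. fst d \<in> E}"
    using assms(5) by (intro image_eqI[of _ _ p]) simp_all
  moreover have "h d \<in> split_off p q z h ` {d. fst d \<in> E}" if "fst d \<in> E" for d
  proof -
    have "h d = split_off p q z h (if d = p \<or> d = q then r else d)"
      using assms by (auto simp: split_off_def)
    then show ?thesis
      by (rule image_eqI) (use that assms(6) in auto)
  qed
  moreover have "z \<notin> h ` {d. fst d \<in> E}"
    using assms(2) by blast
  ultimately have "h ` {d. fst d \<in> E} \<subset> split_off p q z h ` {d. fst d \<in> E}"
    by blast
  then show ?thesis
    unfolding vcount_def using assms(1) by (intro psubset_card_mono) simp_all
qed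

definition even_cover :: "('e \<times> bool \<Rightarrow> 'v) \<Rightarrow> 'e set \<Rightarrow> 'e set \<Rightarrow> bool" where
  "even_cover h E F \<longleftrightarrow> F \<subseteq> E \<and> (\<forall>v. even (dg h F v)) \<and> (\<forall>v. 3 \<le> dg h E v \<longrightarrow> dg h F v \<noteq> 0)"

text \<open>The split may push the degree of \<open>w\<close> below 3, so the cover of the split
  graph promises nothing at \<open>w\<close>; the edge of \<open>p\<close> in \<open>F\<close>
  covers it.\<close>

lemma even_cover_split_off:
  assumes "even_cover (split_off p q z h) E F" "fst p \<in> F" "finite E"
    and fresh: "\<And>d. fst d \<in> E \<Longrightarrow> h d \<noteq> z" and "h p = w" "h q = w"
  shows "even_cover h E F"
proof -
  have F: "F \<subseteq> E" "finite F"
    using assms(1,3) finite_subset by (auto simp: even_cover_def)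
  have "z \<noteq> w"
    using fresh[of p] F assms(2,5) by auto
  note dgs = dg_split_off[of _ h z p w q, OF _ _ assms(5,6) this]
  have E: "dg h E x = (if x = w then dg (split_off p q z h) E w + dg (split_off p q z h) E z
    else if x = z then 0 else dg (split_off p q z h) E x)" for x
    using dgs[OF assms(3) fresh] .
  have F': "dg h F x = (if x = w then dg (split_off p q z h) F w + dg (split_off p q z h) F z
    else if x = z then 0 else dg (split_off p q z h) F x)" for x
    by (rule dgs[OF F(2)]) (use F fresh in blast)
  have "dg h F w \<noteq> 0"
    using F(2) assms(2,5) by (rule dg_pos)
  then show ?thesis
    using assms(1) F(1) unfolding even_cover_def by (auto simp: E F')
qed

text \<open>The degrees of \<open>F\<close> at \<open>u\<close> and \<open>v\<close> have an even
  sum, hence equal parity; adding the contracted edge when both are odd repairs both at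
  once.\<close>

lemma even_lift_merge:
  assumes "finite F" "h f = u" "h (flip f) = v" "u \<noteq> v" "fst f \<notin> F"
    and ev: "\<And>x. even (dg (merge u v h) F x)"
  obtains F' where "F \<subseteq> F'" "F' \<subseteq> insert (fst f) F" "\<And>x. even (dg h F' x)"
    "\<And>x. x \<noteq> u \<Longrightarrow> x \<noteq> v \<Longrightarrow> dg h F' x = dg (merge u v h) F x"
proof -
  have uv: "even (dg h F u) \<longleftrightarrow> even (dg h F v)"
    using ev[of u] dg_merge[OF assms(1,4), of h u] by simp
  have other: "dg h F x = dg (merge u v h) F x" if "x \<noteq> u" "x \<noteq> v" for x
    using dg_merge[OF assms(1,4), of h x] that by simp
  define F' where "F' = (if even (dg h F u) then F else insert (fst f) F)"
  have "dg h F' x = dg h F x + (if even (dg h F u) then 0 else of_bool (x = u) + of_bool (x = v))" for x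
    using dg_insert[OF assms(1,5), of h x] assms(2,3) by (auto simp: F'_def)
  then have "even (dg h F' x)" "x \<noteq> u \<Longrightarrow> x \<noteq> v \<Longrightarrow> dg h F' x = dg (merge u v h) F x" for x
    using uv other[of x] ev[of x] assms(4) by (cases "x = u"; cases "x = v"; auto)+
  then show thesis
    by (rule that[of F', rotated 2]) (auto simp: F'_def)
qed

lemma even_pair:
  assumes "{d. fst d \<in> E \<and> h d = u} = {p, q}" "p \<noteq> q" "F \<subseteq> E" "even (dg h F u)" "fst p \<in> F"
  shows "fst q \<in> F"
proof (rule ccontr)
  assume "fst q \<notin> F"
  then have "{d. fst d \<in> F \<and> h d = u} = {p}"
    using assms(1,3,5) by blast
  then show False
    using assms(4) by (simp add: dg_def)
qed

lemma dg_remove_merge: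
  assumes "finite E" "fst f \<in> E" "h f = u" "h (flip f) = v" "u \<noteq> v"
  shows "dg (merge u v h) (E - {fst f}) x
    = (if x = u then dg h E u + dg h E v - 2 else if x = v then 0 else dg h E x)"
  using dg_merge[of "E - {fst f}" u v h x] dg_remove[OF assms(1,2), of h] assms by auto

lemma obtain_distinct_list:
  assumes "n \<le> card A" "finite A"
  obtains xs where "distinct xs" "length xs = n" "set xs \<subseteq> A"
  by (metis assms obtain_subset_with_card_n finite_distinct_list distinct_card)

text \<open>A loop takes two of at most three darts at \<open>u\<close>, which would leave the edge
  of \<open>p\<close> as a bridge.\<close>

lemma bridgeless_flip_neq:
  assumes "bridgeless h E" "finite E" "fst p \<in> E" "h p = u" "h (flip p) \<noteq> u"
    and "dg h E u \<le> 3" "fst f \<in> E" "h f = u"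
  shows "h (flip f) \<noteq> u"
proof
  assume "h (flip f) = u"
  then have "fst f \<in> {e\<in>E. h (e, True) = u \<and> h (e, False) = u}"
    using assms(7,8) by (cases f; cases "snd f") (auto simp: flip_def)
  then have "1 \<le> card {e\<in>E. h (e, True) = u \<and> h (e, False) = u}"
    using assms(2) by (intro card_pos) auto
  moreover have "1 \<le> card (crossing h E {u})"
    using assms(2-5) by (intro card_pos[of _ "fst p"]) (auto simp: crossing_iff_dart)
  moreover have "card (crossing h E {u}) \<noteq> 1"
    using assms(1) by (simp add: bridgeless_def)
  ultimately show False
    using dg_loops[OF assms(2), of h u] assms(6) by linarith
qed

lemma bridgeless_dg_neq_1:
  assumes "bridgeless h E" "finite E"
  shows "dg h E u \<noteq> 1"
proof
  assume "dg h E u = 1"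
  then have "card (crossing h E {u}) = 1"
    using dg_loops[OF assms(2), of h u] by presburger
  then show False
    using assms(1) by (simp add: bridgeless_def)
qed

lemma vcount_merge:
  fixes h :: "'e \<times> bool \<Rightarrow> 'v"
  assumes "finite E" "fst p \<in> E" "fst p \<noteq> fst f" "h p = u" "h f = u" "h (flip f) = v" "u \<noteq> v"
  shows "vcount h E \<le> Suc (vcount (merge u v h) (E - {fst f}))"
proof (rule vcount_le_Suc[of _ _ _ v])
  fix d assume d: "fst d \<in> E" "h d \<noteq> v"
  show "\<exists>d'. fst d' \<in> E - {fst f} \<and> merge u v h d' = h d"
  proof (cases "fst d = fst f")
    case True
    then show ?thesis
      using d assms(2-6) by (intro exI[of _ p]) (auto simp: merge_def same_edge_cases)
  next
    case False
    then show ?thesis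
      using d by (intro exI[of _ d]) (auto simp: merge_def)
  qed
qed (use assms in simp)

lemma split_off_bridgeless_candidates:
  assumes "bridgeless h E" "finite E" "fst p \<in> E" "h p = w"
    and S: "\<And>d. d \<in> S \<Longrightarrow> fst d \<in> E \<and> h d = w" "p \<notin> S" "3 \<le> card S \<or> dg h E w = 4 \<and> 2 \<le> card S"
    and fresh: "\<And>d. fst d \<in> E \<Longrightarrow> h d \<noteq> z"
  obtains q where "q \<in> S" "bridgeless (split_off p q z h) E"
proof -
  have finS: "finite S"
    using S(3) card.infinite by fastforce
  have "\<exists>q\<in>S. bridgeless (split_off p q z h) E"
    using S(3)
  proof
    assume "3 \<le> card S"
    then obtain xs where "distinct xs" "length xs = 3" "set xs \<subseteq> S"
      using obtain_distinct_list finS by metis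
    then obtain q r s where qrs: "distinct [q, r, s]" "q \<in> S" "r \<in> S" "s \<in> S"
      by (auto simp: length_Suc_conv numeral_3_eq_3)
    then have "distinct [p, q, r, s]"
      using S(2) by auto
    then show ?thesis
      using split_off_bridgeless_three[OF assms(1,2,4) _ _ _ _ assms(3) _ _ _ fresh, of q r s] qrs S(1)
      by auto
  next
    assume 4: "dg h E w = 4 \<and> 2 \<le> card S"
    then obtain xs where "distinct xs" "length xs = 2" "set xs \<subseteq> S"
      using obtain_distinct_list finS by metis
    then obtain q r where qr: "q \<noteq> r" "q \<in> S" "r \<in> S"
      by (auto simp: length_Suc_conv numeral_2_eq_2)
    have "p \<noteq> q" "p \<noteq> r"
      using qr S(2) by auto
    then have D: "{p, q, r} \<subseteq> {d. fst d \<in> E \<and> h d = w}" "card {p, q, r} = 3"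
      using qr S(1) assms(3,4) by auto
    then have "card ({d. fst d \<in> E \<and> h d = w} - {p, q, r}) = 1"
      using 4 card_Diff_subset[of "{p, q, r}"] by (simp add: dg_def)
    then obtain s where s: "{d. fst d \<in> E \<and> h d = w} - {p, q, r} = {s}"
      using card_1_singletonE by blast
    then have "{d. fst d \<in> E \<and> h d = w} = {p, q, r, s}" "distinct [p, q, r, s]"
      using D(1) qr S(2) by auto
    then show ?thesis
      using split_off_bridgeless_degree4[OF assms(1,2) _ _ fresh, of w p q r s] qr(2,3) by blast
  qed
  then show thesis
    using that by blast
qed

lemma mem_if_even_split_off:
  assumes "\<And>d. fst d \<in> F \<Longrightarrow> h d \<noteq> z" "fst p \<in> F" "p \<noteq> q" "even (dg (split_off p q z h) F z)"
  shows "fst q \<in> F"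
proof (rule ccontr)
  assume "fst q \<notin> F"
  then have "{d. fst d \<in> F \<and> split_off p q z h d = z} = {p}"
    using assms(1-3) by (auto simp: split_off_def split: if_splits)
  then show False
    using assms(4) by (simp add: dg_def)
qed

text \<open>Fleischner's theorem, strengthened by a prescribed edge so that the induction closes.
  The infinite vertex type supplies fresh vertices for the splits.\<close>

lemma even_cover_exists:
  fixes h :: "'e \<times> bool \<Rightarrow> 'v" and p :: "'e \<times> bool"
  assumes "infinite (UNIV :: 'v set)" "finite E" "bridgeless h E" "fst p \<in> E"
  shows "\<exists>F. even_cover h E F \<and> fst p \<in> F"
  using assms(2-4)
proof (induction "2 * card E - vcount h E" arbitrary: E h p rule: less_induct)
  case less
  note fin = less.prems(1) and bl = less.prems(2) and p = less.prems(3)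
  define u where "u = h p"
  let ?D = "\<lambda>x. {d. fst d \<in> E \<and> h d = x}"
  have finD: "finite (?D x)" for x
    using fin by simp
  have cardE: "card (E - {fst d}) = card E - 1" "card E \<ge> 1" if "fst d \<in> E" for d :: "'e \<times> bool"
    using that fin card_pos by auto
  obtain z where z: "\<And>d. fst d \<in> E \<Longrightarrow> h d \<noteq> z"
    using ex_fresh[OF assms(1) fin] by metis
  consider "4 \<le> dg h E u" | "dg h E u \<le> 3" "h (flip p) = u" | "dg h E u \<le> 3" "h (flip p) \<noteq> u"
    by linarith
  then show ?case
  proof cases
    \<comment> \<open>High degree: split the prescribed dart off together with one of at least three
      others.\<close>
    case 1
    have "p \<in> ?D u"
      using p u_def by simp
    then have c: "3 \<le> card (?D u - {p})"
      using 1 finD by (simp add: dg_def)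
    obtain q where q: "q \<in> ?D u - {p}" "bridgeless (split_off p q z h) E"
      by (rule split_off_bridgeless_candidates[OF bl fin p u_def[symmetric] _ _ _ z, of "?D u - {p}"])
        (use c in auto)
    have "card (?D u - {p} - {q}) \<noteq> 0"
      using c q(1) finD by simp
    then obtain r where r: "r \<in> ?D u - {p} - {q}"
      by (metis (no_types, lifting) card.empty ex_in_conv)
    have "vcount h E < vcount (split_off p q z h) E"
      by (rule vcount_split_off[of E h z p u q r, OF fin z]) (use q(1) r p u_def in auto)
    moreover have "vcount (split_off p q z h) E \<le> 2 * card E"
      using vcount_le[OF fin] .
    ultimately have "2 * card E - vcount (split_off p q z h) E < 2 * card E - vcount h E"
      by linarith
    then obtain F where F: "even_cover (split_off p q z h) E F" "fst p \<in> F"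
      using less.hyps[OF _ fin q(2) p] by blast
    then have "even_cover h E F"
      using even_cover_split_off[OF F fin z, of u] q(1) u_def by auto
    then show ?thesis
      using F(2) by blast
  next
    case 2
    have "fst p \<in> {e\<in>E. h (e, True) = u \<and> h (e, False) = u}"
      using p u_def 2 by (cases p; cases "snd p") (auto simp: flip_def)
    then have "1 \<le> card {e\<in>E. h (e, True) = u \<and> h (e, False) = u}"
      using fin by (intro card_pos) auto
    moreover have "card (crossing h E {u}) \<noteq> 1"
      using bl by (simp add: bridgeless_def)
    \<comment> \<open>The loop accounts for 2 of at most 3, and a remainder of 1 would be a bridge.
      So \<open>u\<close> carries this loop alone, and the loop can be removed and added back at the
      end.\<close>
    ultimately have dgu: "dg h E u = 2"
      using dg_loops[OF fin, of h u] 2(1) by presburger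
    let ?E = "E - {fst p}"
    have dgE: "dg h E x = dg h ?E x + (if x = u then 2 else 0)" for x
      using dg_remove[OF fin p, of h x] 2(2) u_def by auto
    have "crossing h ?E X = crossing h E X" for X
      using 2(2) u_def crossing_iff_dart[of p h E X] by (auto simp: crossing_def)
    then have bl': "bridgeless h ?E"
      using bl by (simp add: bridgeless_def)
    have "\<exists>F. even_cover h ?E F"
    proof (cases "?E = {}")
      case True
      then show ?thesis
        by (intro exI[of _ "{}"]) (simp only: even_cover_def dg_def True, simp)
    next
      case False
      then obtain e where "e \<in> ?E"
        by blast
      \<comment> \<open>The induction hypothesis needs some prescribed edge; any remaining one will
        do.\<close>
      then have e: "fst (e, True) \<in> ?E"
        by simp
      have "vcount h E \<le> Suc (vcount h ?E)"
      proof (rule vcount_le_Suc[of _ _ _ u])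
        fix d assume "fst d \<in> E" "h d \<noteq> u"
        then show "\<exists>d'. fst d' \<in> ?E \<and> h d' = h d"
          using 2(2) u_def by (intro exI[of _ d]) (auto simp: same_edge_cases)
      qed (use fin in simp)
      moreover have "vcount h ?E \<le> 2 * card ?E"
        using fin by (intro vcount_le) simp
      ultimately have "2 * card ?E - vcount h ?E < 2 * card E - vcount h E"
        using cardE[OF p] by linarith
      then show ?thesis
        using less.hyps[OF _ _ bl' e] fin by auto
    qed
    then obtain F where F: "even_cover h ?E F"
      by blast
    then have "fst p \<notin> F" "finite F"
      using fin finite_subset by (auto simp: even_cover_def)
    then have dgF: "dg h (insert (fst p) F) x = dg h F x + (if x = u then 2 else 0)" for x
      using dg_insert[of F p h x] 2(2) u_def by auto
    have "dg h (insert (fst p) F) x \<noteq> 0" if "3 \<le> dg h E x" for x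
    proof (cases "x = u")
      case False
      then have "3 \<le> dg h ?E x"
        using that dgE[of x] by simp
      then show ?thesis
        using F dgF[of x] by (simp add: even_cover_def)
    qed (simp add: dgF)
    moreover have "even (dg h (insert (fst p) F) x)" for x
      using F dgF[of x] by (simp add: even_cover_def)
    moreover have "insert (fst p) F \<subseteq> E"
      using F p by (auto simp: even_cover_def)
    ultimately have "even_cover h E (insert (fst p) F)"
      by (simp add: even_cover_def)
    then show ?thesis
      by blast
  next
    case 3
    have "dg h E u \<noteq> 1"
      using bridgeless_dg_neq_1[OF bl fin] .
    moreover have "p \<in> ?D u"
      using p u_def by simp
    ultimately have "card (?D u - {p}) \<noteq> 0"
      using dg_pos[OF fin p, of h u] u_def by (simp add: dg_def)
    then obtain f where f: "f \<in> ?D u - {p}"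
      by (metis (no_types, lifting) card.empty ex_in_conv)
    define v where "v = h (flip f)"
    have fE: "fst f \<in> E" "h f = u" "f \<noteq> p"
      using f by auto
    have vu: "u \<noteq> v"
      using bridgeless_flip_neq[OF bl fin p u_def[symmetric] 3(2,1) fE(1,2)] v_def by auto
    have pf: "fst p \<noteq> fst f"
      using fE 3(2) by (auto simp: same_edge_cases)
    let ?E = "E - {fst f}" and ?h = "merge u v h"
    have finE: "finite ?E" and pE: "fst p \<in> ?E"
      using fin p pf by auto
    have bl1: "bridgeless ?h ?E"
      using bridgeless_merge[OF bl fE(2) v_def[symmetric] vu] .
    have vc: "vcount h E \<le> Suc (vcount ?h ?E)"
      using vcount_merge[OF fin p pf u_def[symmetric] fE(2) v_def[symmetric] vu] .
    have dg1: "dg ?h ?E x = (if x = u then dg h E u + dg h E v - 2 else if x = v then 0 else dg h E x)" for x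
      using dg_remove_merge[OF fin fE(1,2) v_def[symmetric] vu] .
    \<comment> \<open>After contracting \<open>f\<close>, lifting back preserves everything except
      coverage of the two ends. The prescribed edge covers \<open>u\<close>, so only
      \<open>v\<close> remains, to be settled separately in each case.\<close>
    have lift: "\<exists>F'. even_cover h E F' \<and> fst p \<in> F'"
      if F: "F \<subseteq> ?E" "fst p \<in> F" "\<And>x. even (dg ?h F x)"
        and cov: "\<And>x. x \<noteq> u \<Longrightarrow> x \<noteq> v \<Longrightarrow> 3 \<le> dg h E x \<Longrightarrow> dg ?h F x \<noteq> 0"
        and v: "\<And>F'. F \<subseteq> F' \<Longrightarrow> F' \<subseteq> E \<Longrightarrow> even (dg h F' u) \<Longrightarrow> 3 \<le> dg h E v \<Longrightarrow> dg h F' v \<noteq> 0" for F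
    proof -
      have "fst f \<notin> F" "finite F"
        using F(1) finE finite_subset by auto
      then obtain F' where F': "F \<subseteq> F'" "F' \<subseteq> insert (fst f) F" "\<And>x. even (dg h F' x)"
        "\<And>x. x \<noteq> u \<Longrightarrow> x \<noteq> v \<Longrightarrow> dg h F' x = dg ?h F x"
        using even_lift_merge[OF _ fE(2) v_def[symmetric] vu] F(3) by metis
      have sub: "F' \<subseteq> E" "finite F'" "fst p \<in> F'"
        using F'(1,2) F(1,2) fE(1) \<open>finite F\<close> finite_subset[OF F'(2)] by auto
      have "dg h F' x \<noteq> 0" if "3 \<le> dg h E x" for x
      proof -
        have "dg h F' u \<noteq> 0"
          using sub(2,3) u_def[symmetric] by (rule dg_pos)
        then show ?thesis
          using that cov[of x] F'(3,4) v[OF F'(1) sub(1)] by (cases "x = u"; cases "x = v") auto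
      qed
      then have "even_cover h E F'"
        using F'(3) sub(1) by (simp add: even_cover_def)
      then show ?thesis
        using sub(3) by blast
    qed
    show ?thesis
    \<comment> \<open>If \<open>u\<close> has degree 2, parity forces \<open>f\<close> into the
      lifted subgraph along with \<open>p\<close>, which covers \<open>v\<close>. If
      \<open>v\<close> has degree at most 2, it needs no covering.\<close>
    proof (cases "dg h E u = 2 \<or> dg h E v \<le> 2")
      case True
      have "vcount ?h ?E \<le> 2 * card ?E"
        using vcount_le[OF finE] .
      then have "2 * card ?E - vcount ?h ?E < 2 * card E - vcount h E"
        using vc cardE[OF p] cardE[OF fE(1)] by linarith
      then obtain F where F: "even_cover ?h ?E F" "fst p \<in> F"
        using less.hyps[OF _ finE bl1 pE] by blast
      show ?thesis
      proof (rule lift)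
        fix F' assume F': "F \<subseteq> F'" "F' \<subseteq> E" "even (dg h F' u)" "3 \<le> dg h E v"
        then have "card (?D u) = 2"
          using True by (simp add: dg_def)
        then have "?D u = {p, f}"
          using fE p u_def card_subset_eq[OF finD, of "{p, f}" u] by auto
        then have "fst f \<in> F'"
          using even_pair[of E h u p f F'] fE(3) F' F(2) by auto
        moreover have "finite F'"
          using F'(2) fin finite_subset by blast
        ultimately show "dg h F' v \<noteq> 0"
          using v_def by (intro dg_pos[of _ "flip f"]) auto
      qed (use F dg1 in \<open>auto simp: even_cover_def\<close>)
    next
      case False
      then have dgu: "dg h E u = 3" and dgv: "3 \<le> dg h E v"
        using 3(1) \<open>dg h E u \<noteq> 1\<close> dg_pos[OF fin p, of h u] u_def by auto
      \<comment> \<open>Here \<open>p\<close> is paired with a dart \<open>q\<close> that belonged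
        to \<open>v\<close>: parity at the fresh vertex then forces the edge of \<open>q\<close>
        into the subgraph, so \<open>v\<close> is covered. The merged vertex has degree
        \<open>dg h E v + 1\<close>. For \<open>dg h E v = 3\<close> there are only two candidates
        but the degree is 4; otherwise there are at least three.\<close>
      define S where "S = ?D v - {flip f}"
      have "flip f \<in> ?D v"
        using fE(1) v_def by simp
      then have cS: "card S = dg h E v - 1"
        using finD unfolding S_def dg_def by simp
      have S: "fst d \<in> ?E \<and> ?h d = u" if "d \<in> S" for d
        using that vu fE(2) by (auto simp: S_def merge_def same_edge_cases)
      have hp: "?h p = u"
        using u_def vu by (simp add: merge_def)
      have zE: "?h d \<noteq> z" if "fst d \<in> ?E" for d
        using z[of d] that z[OF fE(1)] fE(2) by (auto simp: merge_def)
      have p_notin: "p \<notin> S"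
        using vu u_def by (simp add: S_def)
      obtain q where q: "q \<in> S" "bridgeless (split_off p q z ?h) ?E"
        by (rule split_off_bridgeless_candidates[OF bl1 finE pE hp S p_notin _ zE])
          (use dgu dgv cS dg1[of u] in auto)
      have "card (S - {q}) \<noteq> 0"
        using q(1) cS dgv by (simp add: card_Diff_singleton)
      then obtain r where r: "r \<in> S" "r \<noteq> q"
        by (metis (no_types, lifting) Diff_iff card.empty ex_in_conv insertI1)
      have "vcount ?h ?E < vcount (split_off p q z ?h) ?E"
        using p_notin r S[OF q(1)] S[OF r(1)] hp pE
        by (intro vcount_split_off[where w = u and r = r] finE zE) auto
      moreover have "vcount (split_off p q z ?h) ?E \<le> 2 * card ?E"
        using vcount_le[OF finE] .
      ultimately have "2 * card ?E - vcount (split_off p q z ?h) ?E < 2 * card E - vcount h E"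
        using vc cardE[OF p] cardE[OF fE(1)] by linarith
      then obtain F where F: "even_cover (split_off p q z ?h) ?E F" "fst p \<in> F"
        using less.hyps[OF _ finE q(2) pE] by blast
      have FE: "F \<subseteq> ?E"
        using F(1) by (simp add: even_cover_def)
      have "fst q \<in> F"
        by (rule mem_if_even_split_off[of F ?h z p])
          (use F FE zE q(1) p_notin in \<open>auto simp: even_cover_def\<close>)
      have "even_cover ?h ?E F"
        using even_cover_split_off[OF F finE zE hp] S[OF q(1)] by auto
      show ?thesis
      proof (rule lift)
        fix F' assume F': "F \<subseteq> F'" "F' \<subseteq> E"
        have "finite F'"
          using F'(2) fin finite_subset by blast
        then show "dg h F' v \<noteq> 0"
          using \<open>fst q \<in> F\<close> F'(1) q(1) by (intro dg_pos[of _ q]) (auto simp: S_def)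
      qed (use F(2) dg1 \<open>even_cover ?h ?E F\<close> in \<open>auto simp: even_cover_def\<close>)
    qed
  qed
qed

lemma dg_Inl: "dg (Inl \<circ> h) F (Inl v) = dg h F v" "dg (Inl \<circ> h) F (Inr n) = 0"
  by (simp_all add: dg_def)

lemma crossing_Inl: "crossing (Inl \<circ> h) E X = crossing h E (Inl -` X)"
  by (simp add: crossing_def)

lemma dg_empty [simp]: "dg h {} v = 0"
  by (simp add: dg_def)

theorem bridgeless_even_cover:
  fixes h :: "'e \<times> bool \<Rightarrow> 'v"
  assumes "finite E" "bridgeless h E"
  obtains F where "F \<subseteq> E" "\<And>v. even (dg h F v)" "\<And>v. 3 \<le> dg h E v \<Longrightarrow> dg h F v \<noteq> 0"
proof (cases "E = {}")
  case True
  then show thesis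
    using that[of "{}"] by simp
next
  case False
  then obtain e where e: "fst (e, True) \<in> E"
    by auto
  \<comment> \<open>The summand \<open>nat\<close> makes the vertex type infinite, as the induction
    requires.\<close>
  let ?h = "Inl \<circ> h :: 'e \<times> bool \<Rightarrow> 'v + nat"
  have "bridgeless ?h E"
    using assms(2) by (simp add: bridgeless_def crossing_Inl)
  then obtain F where "even_cover ?h E F"
    using even_cover_exists[of E ?h "(e, True)"] assms(1) e by auto
  then have "F \<subseteq> E" "\<And>v. even (dg ?h F (Inl v))" "\<And>v. 3 \<le> dg ?h E (Inl v) \<Longrightarrow> dg ?h F (Inl v) \<noteq> 0"
    unfolding even_cover_def by blast+
  then show thesis
    using that unfolding dg_Inl by blast
qed

section \<open>Balanced colourings\<close>

text \<open>A set with empty crossing is a union of components, up to vertices without darts. Both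
  darts of an edge lie on the same side of it, so testing the \<open>True\<close> dart counts each
  edge once.\<close>

definition even_components :: "('e \<times> bool \<Rightarrow> 'v) \<Rightarrow> 'e set \<Rightarrow> bool" where
  "even_components h E \<longleftrightarrow> (\<forall>X. crossing h E X = {} \<longrightarrow> even (card {e\<in>E. h (e, True) \<in> X}))"

lemma crossing_emptyI:
  assumes "\<And>d :: 'e \<times> bool. fst d \<notin> crossing h E X"
  shows "crossing h E X = {}"
proof -
  have "k \<notin> crossing h E X" for k
    using assms[of "(k, True)"] by simp
  then show ?thesis
    by blast
qed

text \<open>An odd part must contain the fresh vertex but can be chosen to avoid \<open>w\<close>.
  Undoing the split either closes a loop, if both darts belong to one edge, or makes exactly the
  edges of \<open>p\<close> and \<open>q\<close> cross.\<close>

lemma split_off_odd_component: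
  assumes "even_components h E" "finite E" "h p = w" "h q = w" "p \<noteq> q" "fst p \<in> E" "fst q \<in> E"
    and fresh: "\<And>d. fst d \<in> E \<Longrightarrow> h d \<noteq> z"
    and "\<not> even_components (split_off p q z h) E"
  shows "q = flip p \<or> (\<exists>X. w \<notin> X \<and> fst p \<noteq> fst q \<and> crossing h E X = {fst p, fst q})"
proof -
  let ?h = "split_off p q z h"
  let ?n = "\<lambda>X. card {e\<in>E. ?h (e, True) \<in> X}"
  obtain X0 where X0: "crossing ?h E X0 = {}" "odd (?n X0)"
    using assms(9) unfolding even_components_def by blast
  have "crossing h E UNIV = {}"
    by (simp add: crossing_def)
  then have "even (card E)"
    using assms(1) unfolding even_components_def by fastforce
  moreover have "?n X0 + ?n (- X0) = card E"
  proof -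
    have "{e\<in>E. ?h (e, True) \<in> X0} \<union> {e\<in>E. ?h (e, True) \<in> - X0} = E"
      by auto
    moreover have "card ({e\<in>E. ?h (e, True) \<in> X0} \<union> {e\<in>E. ?h (e, True) \<in> - X0}) = ?n X0 + ?n (- X0)"
      using assms(2) by (intro card_Un_disjoint) auto
    ultimately show ?thesis
      by simp
  qed
  \<comment> \<open>The total is even, so the complement of an odd part is odd too and
    \<open>w\<close> may be assumed outside.\<close>
  ultimately have "even (?n X0 + ?n (- X0))"
    by simp
  then have "odd (?n (- X0))"
    using X0(2) unfolding even_add by blast
  have "\<exists>X. crossing ?h E X = {} \<and> odd (?n X) \<and> w \<notin> X"
  proof (cases "w \<in> X0")
    case True
    with X0(1) \<open>odd (?n (- X0))\<close> show ?thesis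
      by (intro exI[of _ "- X0"]) simp
  next
    case False
    with X0 show ?thesis
      by blast
  qed
  then obtain X where X: "crossing ?h E X = {}" "odd (?n X)" "w \<notin> X"
    by blast
  have zX: "z \<in> X"
  proof (rule ccontr)
    assume "z \<notin> X"
    then have "crossing h E X = {}"
      using X(1,3) crossing_split_off_same[OF assms(3,4), of X z E] by simp
    moreover have "?h d \<in> X \<longleftrightarrow> h d \<in> X" for d
      using X(3) \<open>z \<notin> X\<close> assms(3,4) by (auto simp: split_off_def)
    ultimately show False
      using assms(1) X(2) unfolding even_components_def by simp
  qed
  show ?thesis
  proof (cases "fst p = fst q")
    case True
    then show ?thesis
      using assms(5) by (auto simp: same_edge_cases)
  next
    case False
    have iff: "k \<in> crossing h E (X - {z}) \<longleftrightarrow> k = fst p \<or> k = fst q" if "k \<in> E" for k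
      using crossing_split_off[OF assms(3-5) zX X(3) fresh that] X(1) False by simp
    have "crossing h E (X - {z}) = {fst p, fst q}"
    proof (intro set_eqI iffI)
      fix k assume k: "k \<in> crossing h E (X - {z})"
      then show "k \<in> {fst p, fst q}"
        using iff[of k] subsetD[OF crossing_subset k] by simp
    next
      fix k assume "k \<in> {fst p, fst q}"
      then show "k \<in> crossing h E (X - {z})"
        using iff[of k] assms(6,7) by auto
    qed
    then show ?thesis
      using X(3) False by blast
  qed
qed

text \<open>A loop at \<open>p\<close> lies in no cut, so it could spoil only one of the two splits.
  Otherwise both failures give 2-edge cuts sharing the edge of \<open>p\<close>, and posimodularity
  would require 4 to be at least 2 + 2 + 2.\<close>

lemma split_off_even_components:
  assumes "even_components h E" "finite E" "bridgeless h E" "h p = w" "h q = w" "h r = w"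
    and "distinct [p, q, r]" "fst p \<in> E" "fst q \<in> E" "fst r \<in> E"
    and fresh: "\<And>d. fst d \<in> E \<Longrightarrow> h d \<noteq> z"
  shows "even_components (split_off p q z h) E \<or> even_components (split_off p r z h) E"
proof (rule ccontr)
  assume contra: "\<not> ?thesis"
  have ne: "p \<noteq> q" "p \<noteq> r" "q \<noteq> r"
    using assms(7) by auto
  have q: "q = flip p \<or> (\<exists>X. w \<notin> X \<and> fst p \<noteq> fst q \<and> crossing h E X = {fst p, fst q})"
    using split_off_odd_component[OF assms(1,2,4,5) ne(1) assms(8,9) fresh] contra by blast
  have r: "r = flip p \<or> (\<exists>X. w \<notin> X \<and> fst p \<noteq> fst r \<and> crossing h E X = {fst p, fst r})"
    using split_off_odd_component[OF assms(1,2,4,6) ne(2) assms(8,10) fresh] contra by blast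
  have loop: "fst p \<notin> crossing h E X" if "h (flip p) = w" for X
    using that assms(4) by (simp add: crossing_iff_dart)
  have "q \<noteq> flip p" "r \<noteq> flip p"
    using q r loop assms(5,6) ne by auto
  then obtain X Y where X: "w \<notin> X" "fst p \<noteq> fst q" "crossing h E X = {fst p, fst q}"
    and Y: "w \<notin> Y" "fst p \<noteq> fst r" "crossing h E Y = {fst p, fst r}"
    using q r by blast
  have qr: "fst q \<noteq> fst r"
    using crossing_iff_dart[of q h E X] X(3) assms(5,6) ne(3) by (auto simp: same_edge_cases)
  have fl: "h (flip p) \<in> X \<inter> Y" "h (flip q) \<in> X - Y" "h (flip r) \<in> Y - X"
    using crossing_iff_dart[of p h E X] crossing_iff_dart[of p h E Y] crossing_iff_dart[of q h E X]
      crossing_iff_dart[of q h E Y] crossing_iff_dart[of r h E X] crossing_iff_dart[of r h E Y]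
      X Y qr assms(4-6,8-10) by simp_all
  have btw: "fst p \<in> between h E (X \<inter> Y) (- (X \<union> Y))" "fst q \<in> between h E (X - Y) (- (X \<union> Y))"
    "fst r \<in> between h E (Y - X) (- (X \<union> Y))"
    using fl X(1) Y(1) assms(4-6,8-10) by (auto intro!: betweenI)
  have "1 \<le> card (between h E (X \<inter> Y) (- (X \<union> Y)))" "1 \<le> card (between h E (X - Y) (- (X \<union> Y)))"
    "1 \<le> card (between h E (Y - X) (- (X \<union> Y)))"
    by (rule card_pos[OF finite_between[OF assms(2)] btw(1)],
        rule card_pos[OF finite_between[OF assms(2)] btw(2)],
        rule card_pos[OF finite_between[OF assms(2)] btw(3)])
  moreover have "card (crossing h E (X - Y)) \<noteq> 1" "card (crossing h E (Y - X)) \<noteq> 1"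
    using assms(3) by (auto simp: bridgeless_def)
  moreover have "card (crossing h E X) = 2" "card (crossing h E Y) = 2"
    using X(2,3) Y(2,3) by simp_all
  ultimately show False
    using crossing_cells(1,2,4,5)[OF assms(2), where h = h and X = X and Y = Y] by linarith
qed

text \<open>Instead of following Eulerian trails, vertices are split until all degrees are 0 or 2,
  keeping components even. The remaining cycles are then coloured alternately by shortening them two
  edges at a time.\<close>

lemma balanced_half:
  fixes h :: "'e \<times> bool \<Rightarrow> 'v"
  assumes "infinite (UNIV :: 'v set)" "finite E" "\<And>v. even (dg h E v)" "even_components h E"
  shows "\<exists>R\<subseteq>E. \<forall>v. 2 * dg h R v = dg h E v"
  using assms(2-4)
proof (induction "2 * card E - vcount h E" arbitrary: E h rule: less_induct)
  case less
  note fin = less.prems(1) and ev = less.prems(2) and ec = less.prems(3)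
  let ?D = "\<lambda>x. {d. fst d \<in> E \<and> h d = x}"
  have finD: "finite (?D x)" for x
    using fin by simp
  obtain z where z: "\<And>d. fst d \<in> E \<Longrightarrow> h d \<noteq> z"
    using ex_fresh[OF assms(1) fin] by metis
  show ?case
  proof (cases "\<exists>w. 3 \<le> dg h E w")
    case True
    then obtain w where "3 \<le> card (?D w)"
      by (auto simp: dg_def)
    then obtain xs where "distinct xs" "length xs = 3" "set xs \<subseteq> ?D w"
      by (rule obtain_distinct_list[OF _ finD])
    then obtain p q0 r0 where d0: "distinct [p, q0, r0]" "p \<in> ?D w" "q0 \<in> ?D w" "r0 \<in> ?D w"
      by (auto simp: length_Suc_conv numeral_3_eq_3)
    then have "even_components (split_off p q0 z h) E \<or> even_components (split_off p r0 z h) E"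
      by (intro split_off_even_components[OF ec fin bridgeless_if_even[OF fin ev], where w = w] z) simp_all
    then obtain q r where d: "p \<noteq> q" "p \<noteq> r" "q \<noteq> r" "p \<in> ?D w" "q \<in> ?D w" "r \<in> ?D w"
      and ec': "even_components (split_off p q z h) E"
    proof
      assume "even_components (split_off p q0 z h) E"
      then show thesis
        using that[of q0 r0] d0 by simp
    next
      assume "even_components (split_off p r0 z h) E"
      then show thesis
        using that[of r0 q0] d0 by auto
    qed
    have zw: "z \<noteq> w"
      using z[of p] d(4) by auto
    let ?h = "split_off p q z h"
    have dgs: "dg h F x = (if x = w then dg ?h F w + dg ?h F z else if x = z then 0 else dg ?h F x)"
      if "F \<subseteq> E" for F x
      using d(4,5) zw by (intro dg_split_off finite_subset[OF that fin] z[OF subsetD[OF that]]) simp_all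
    have "fst d \<in> E \<and> ?h d = z \<longleftrightarrow> d = p \<or> d = q" for d
      using z[of d] d(4,5) by (auto simp: split_off_def)
    then have "{d. fst d \<in> E \<and> ?h d = z} = {p, q}"
      by blast
    then have dz: "dg ?h E z = 2"
      using d(1) by (simp add: dg_def)
    have ev': "even (dg ?h E x)" for x
      using ev[of x] dgs[OF order_refl, of x] dz by (auto split: if_splits)
    have "vcount h E < vcount ?h E"
      by (rule vcount_split_off[of E h z p w q r, OF fin z]) (use d in auto)
    moreover have "vcount ?h E \<le> 2 * card E"
      using vcount_le[OF fin] .
    ultimately have "2 * card E - vcount ?h E < 2 * card E - vcount h E"
      by linarith
    then obtain R where R: "R \<subseteq> E" "\<And>x. 2 * dg ?h R x = dg ?h E x"
      using less.hyps[OF _ fin ev' ec'] by blast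
    have "2 * dg h R x = dg h E x" for x
      using dgs[OF R(1), of x] dgs[OF order_refl, of x] R(2)[of x] R(2)[of z] by auto
    then show ?thesis
      using R(1) by blast
  next
    case False
    show ?thesis
    proof (cases "E = {}")
      case True
      then show ?thesis
        by simp
    next
      case nonempty: False
      have small: "dg h E x = 0 \<or> dg h E x = 2" for x
      proof -
        have "dg h E x < 3"
          using False by (simp add: not_le)
        then have "dg h E x = 0 \<or> dg h E x = 1 \<or> dg h E x = 2"
          by linarith
        then show ?thesis
          using ev[of x] by auto
      qed
      obtain p :: "'e \<times> bool" where p: "fst p \<in> E"
        using nonempty by fastforce
      define u where "u = h p"
      have "p \<in> ?D u"
        using p u_def by simp
      have dgu: "card (?D u) = 2"
        using small[of u] dg_pos[OF fin p, of h u] u_def by (auto simp: dg_def)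
      then have "card (?D u - {p}) = 1"
        using \<open>p \<in> ?D u\<close> finD by simp
      then obtain q where "?D u - {p} = {q}"
        using card_1_singletonE by blast
      then have Du: "?D u = {p, q}" and pq: "p \<noteq> q"
        using \<open>p \<in> ?D u\<close> by auto
      then have q: "fst q \<in> E" "h q = u"
        by auto
      \<comment> \<open>A loop at a vertex of degree 2 would be a component with one edge.\<close>
      have "q \<noteq> flip p"
      proof
        assume "q = flip p"
        then have Du': "fst d \<in> E \<and> h d = u \<longleftrightarrow> d = p \<or> d = flip p" for d :: "'e \<times> bool"
          using Du by blast
        have flip_u: "h d = u \<longleftrightarrow> h (flip d) = u" if "fst d \<in> E" for d
          using that Du'[of d] Du'[of "flip d"] by (metis flip_flip fst_flip)
        have "crossing h E {u} = {}"
          by (rule crossing_emptyI) (use flip_u in \<open>metis crossing_iff_dart singleton_iff\<close>)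
        moreover have "e \<in> E \<and> h (e, True) = u \<longleftrightarrow> e = fst p" for e
          using Du'[of "(e, True)"] by (cases p; cases "snd p") (auto simp: flip_def)
        then have "{e\<in>E. h (e, True) \<in> {u}} = {fst p}"
          by auto
        ultimately show False
          using ec[unfolded even_components_def, rule_format, of "{u}"] by simp
      qed
      then have fpq: "fst p \<noteq> fst q"
        using pq by (auto simp: same_edge_cases)
      define x y where "x = h (flip p)" and "y = h (flip q)"
      have "flip p \<notin> ?D u" "flip q \<notin> ?D u"
        unfolding Du using fpq by (auto simp: same_edge_cases)
      then have xu: "x \<noteq> u" "y \<noteq> u"
        using p q x_def y_def by auto
      \<comment> \<open>The path from \<open>x\<close> through \<open>u\<close> to \<open>y\<close>
        is removed and its ends are identified: the cycle becomes two edges shorter, so its parity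
        is unchanged.\<close>
      let ?E = "E - {fst p} - {fst q}" and ?h = "merge x y h"
      have finE: "finite ?E"
        using fin by simp
      have dgE: "dg h E v = dg h ?E v + (if v = u then 2 else 0) + of_bool (v = x) + of_bool (v = y)" for v
        using dg_remove[OF fin p, of h v] dg_remove[of "E - {fst p}" q h v] fin q fpq u_def x_def y_def
        by auto
      have dgu0: "dg h ?E u = 0"
        using dgE[of u] small[of u] by simp
      have out: "h d \<noteq> u" if "fst d \<in> ?E" for d :: "'e \<times> bool"
        using dg_pos[OF finE that, of h u] dgu0 by auto
      have dg1: "dg ?h F v = (if x = y then dg h F v
          else if v = x then dg h F x + dg h F y else if v = y then 0 else dg h F v)" if "finite F" for F v
      proof (cases "x = y")
        case True
        then have "?h = h"
          by (auto simp: merge_def)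
        then show ?thesis
          using True by simp
      next
        case False
        then show ?thesis
          using dg_merge[OF that False, of h v] by simp
      qed
      have ev2: "even (dg h ?E v + of_bool (v = x) + of_bool (v = y))" for v
        using ev[of v] unfolding dgE[of v] by (cases "v = u") simp_all
      have ev': "even (dg ?h ?E v)" for v
      proof (cases "x = y")
        case True
        then show ?thesis
          using ev2[of v] unfolding dg1[OF finE] by (cases "v = y") simp_all
      next
        case False
        then show ?thesis
          using ev2[of v] ev2[of x] ev2[of y] unfolding dg1[OF finE]
          by (cases "v = x"; cases "v = y") simp_all
      qed
      have ec': "even_components ?h ?E"
        unfolding even_components_def
      proof (intro allI impI)
        fix X assume X: "crossing ?h ?E X = {}"
        \<comment> \<open>\<open>Y\<close> pulls \<open>X\<close> back along the identification and
          puts \<open>u\<close> on the side of \<open>x\<close> and \<open>y\<close>. Neither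
          removed edge crosses it, and they add 0 or 2 to the edge count.\<close>
        define Y where "Y = {v. v \<noteq> u \<and> (if v = y then x \<in> X else v \<in> X)} \<union> (if x \<in> X then {u} else {})"
        have mem: "?h d \<in> X \<longleftrightarrow> h d \<in> Y" if "fst d \<in> ?E" for d :: "'e \<times> bool"
          using out[OF that] by (auto simp: merge_def Y_def)
        have xy: "x \<in> Y \<longleftrightarrow> x \<in> X" "y \<in> Y \<longleftrightarrow> x \<in> X" "u \<in> Y \<longleftrightarrow> x \<in> X"
          using xu by (auto simp: Y_def)
        have "fst d \<notin> crossing h E Y" for d :: "'e \<times> bool"
        proof (cases "fst d \<in> ?E")
          case True
          then show ?thesis
            using X mem[of d] mem[of "flip d"] crossing_iff_dart[of d ?h ?E X]
            by (auto simp: crossing_iff_dart)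
        next
          case False
          have "fst p \<notin> crossing h E Y" "fst q \<notin> crossing h E Y"
            using xy u_def x_def y_def q(2) by (auto simp: crossing_iff_dart)
          then show ?thesis
            using False subsetD[OF crossing_subset, of "fst d" h E Y] by auto
        qed
        then have "crossing h E Y = {}"
          by (rule crossing_emptyI)
        then have "even (card {e\<in>E. h (e, True) \<in> Y})"
          using ec unfolding even_components_def by blast
        moreover have "{e\<in>E. h (e, True) \<in> Y} = {e\<in>?E. ?h (e, True) \<in> X} \<union> (if x \<in> X then {fst p, fst q} else {})"
        proof -
          have pT: "h (fst p, True) \<in> Y \<longleftrightarrow> x \<in> X"
            using xy u_def x_def by (cases p; cases "snd p") (auto simp: flip_def)
          have qT: "h (fst q, True) \<in> Y \<longleftrightarrow> x \<in> X"
            using xy q(2) y_def by (cases q; cases "snd q") (auto simp: flip_def)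
          show ?thesis
            using pT qT mem[of "(e, True)" for e] p q(1) by auto
        qed
        ultimately have "even (card ({e\<in>?E. ?h (e, True) \<in> X} \<union> (if x \<in> X then {fst p, fst q} else {})))"
          by simp
        moreover have "card ({e\<in>?E. ?h (e, True) \<in> X} \<union> (if x \<in> X then {fst p, fst q} else {}))
            = card {e\<in>?E. ?h (e, True) \<in> X} + card (if x \<in> X then {fst p, fst q} else {})"
          using fin by (intro card_Un_disjoint) auto
        ultimately show "even (card {e\<in>?E. ?h (e, True) \<in> X})"
          using fpq by (auto split: if_splits)
      qed
      have cE: "card ?E = card E - 2" "2 \<le> card E"
      proof -
        have "card {fst p, fst q} \<le> card E"
          using fin p q by (intro card_mono) auto
        then show "2 \<le> card E"
          using fpq by simp
        show "card ?E = card E - 2"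
          using fin p q fpq by simp
      qed
      \<comment> \<open>At most \<open>u\<close>, \<open>x\<close> and \<open>y\<close> disappear,
        whereas \<open>2 * card E\<close> falls by 4.\<close>
      have "vcount h E \<le> vcount ?h ?E + 3"
      proof -
        have "h ` {d. fst d \<in> E} \<subseteq> {u, x, y} \<union> ?h ` {d. fst d \<in> ?E}"
        proof
          fix v assume "v \<in> h ` {d. fst d \<in> E}"
          then obtain d where d: "fst d \<in> E" "v = h d"
            by blast
          show "v \<in> {u, x, y} \<union> ?h ` {d. fst d \<in> ?E}"
          proof (cases "fst d \<in> ?E \<and> v \<noteq> y")
            case True
            then have "v = ?h d"
              using d by (simp add: merge_def)
            then show ?thesis
              using True by (intro UnI2 image_eqI[of _ _ d]) simp_all
          next
            case False
            then show ?thesis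
              using d u_def x_def y_def q(2) by (auto simp: same_edge_cases)
          qed
        qed
        then have "vcount h E \<le> card ({u, x, y} \<union> ?h ` {d. fst d \<in> ?E})"
          unfolding vcount_def by (intro card_mono) (use finE in simp_all)
        also have "\<dots> \<le> card {u, x, y} + vcount ?h ?E"
          unfolding vcount_def by (rule card_Un_le)
        also have "card {u, x, y} \<le> 3"
          by (simp add: card_insert_if)
        finally show ?thesis
          by simp
      qed
      moreover have "vcount ?h ?E \<le> 2 * card ?E"
        using vcount_le[OF finE] .
      ultimately have "2 * card ?E - vcount ?h ?E < 2 * card E - vcount h E"
        using cE by linarith
      then obtain R where R: "R \<subseteq> ?E" "\<And>v. 2 * dg ?h R v = dg ?h ?E v"
        using less.hyps[OF _ finE ev' ec'] by blast
      have finR: "finite R" and pR: "fst p \<notin> R" "fst q \<notin> R"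
        using R(1) finite_subset[OF R(1) finE] by auto
      have Ru: "dg h R u = 0"
      proof -
        have "{d. fst d \<in> R \<and> h d = u} = {}"
          using out R(1) by blast
        then show ?thesis
          by (simp only: dg_def card.empty)
      qed
      have addp: "dg h (insert (fst p) R) v = dg h R v + of_bool (v = u) + of_bool (v = x)" for v
        using dg_insert[OF finR pR(1), of h v] u_def x_def by auto
      have addq: "dg h (insert (fst q) R) v = dg h R v + of_bool (v = u) + of_bool (v = y)" for v
        using dg_insert[OF finR pR(2), of h v] q(2) y_def by auto
      \<comment> \<open>For distinct ends, exactly one of them already meets \<open>R\<close>; the
        removed edge to the other end joins \<open>R\<close>. For equal ends the edge of
        \<open>p\<close> works.\<close>
      have "(\<forall>v. 2 * dg h (insert (fst p) R) v = dg h E v) \<or> (\<forall>v. 2 * dg h (insert (fst q) R) v = dg h E v)"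
      proof (cases "x = y")
        case True
        have "2 * dg h (insert (fst p) R) v = dg h E v" for v
          using R(2)[of v] dg1[OF finR, of v] dg1[OF finE, of v] True addp[of v] dgE[of v] xu by auto
        then show ?thesis
          by blast
      next
        case False
        have dgx: "dg h E x = 2" "dg h E y = 2"
          using small[of x] small[of y] dgE[of x] dgE[of y] by auto
        then have "dg h ?E x = 1" "dg h ?E y = 1"
          using dgE[of x] dgE[of y] xu False by auto
        then have "dg h R x + dg h R y = 1"
          using R(2)[of x] dg1[OF finR, of x] dg1[OF finE, of x] False by simp
        then consider "dg h R x = 1" "dg h R y = 0" | "dg h R x = 0" "dg h R y = 1"
          by linarith
        then show ?thesis
        proof cases
          case 1
          have "2 * dg h (insert (fst q) R) v = dg h E v" for v
            using R(2)[of v] dg1[OF finR, of v] dg1[OF finE, of v] False addq[of v] dgE[of v] xu 1 dgx Ru dgu0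
            by (cases "v = u"; cases "v = x"; cases "v = y") auto
          then show ?thesis
            by blast
        next
          case 2
          have "2 * dg h (insert (fst p) R) v = dg h E v" for v
            using R(2)[of v] dg1[OF finR, of v] dg1[OF finE, of v] False addp[of v] dgE[of v] xu 2 dgx Ru dgu0
            by (cases "v = u"; cases "v = x"; cases "v = y") auto
          then show ?thesis
            by blast
        qed
      qed
      moreover have "insert (fst p) R \<subseteq> E" "insert (fst q) R \<subseteq> E"
        using R(1) p q by auto
      ultimately show ?thesis
        by blast
    qed
  qed
qed

theorem even_components_balanced_half:
  fixes h :: "'e \<times> bool \<Rightarrow> 'v"
  assumes "finite E" "\<And>v. even (dg h E v)" "even_components h E"
  obtains R where "R \<subseteq> E" "\<And>v. 2 * dg h R v = dg h E v"
proof -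
  let ?h = "Inl \<circ> h :: 'e \<times> bool \<Rightarrow> 'v + nat"
  have "even_components ?h E"
    using assms(3) by (auto simp: even_components_def crossing_Inl)
  moreover have "even (dg ?h E v)" for v
    using assms(2) by (cases v) (auto simp: dg_Inl)
  ultimately obtain R where "R \<subseteq> E" "\<forall>v. 2 * dg ?h R v = dg ?h E v"
    using balanced_half[of E ?h] assms(1) by auto
  then show thesis
    using that[of R] dg_Inl(1) by metis
qed

section \<open>Splitting cycles\<close>

text \<open>Connectivity in the only shape used later: a property preserved along edges spreads to
  the whole vertex set.\<close>

lemma connected_sg_invariant:
  assumes "connected_sg ends W D" "a \<in> W" "b \<in> W" "P a"
    and step: "\<And>e x y. e \<in> D \<Longrightarrow> ends e = {x, y} \<Longrightarrow> x \<in> W \<Longrightarrow> y \<in> W \<Longrightarrow> P x \<Longrightarrow> P y"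
  shows "P b"
proof -
  have "(\<lambda>u v. u \<in> W \<and> v \<in> W \<and> adj ends D u v)\<^sup>*\<^sup>* a b"
    using assms(1-3) by (simp add: connected_sg_def)
  then show ?thesis
    by (induction rule: rtranclp_induct) (use assms(4) step in \<open>auto simp: adj_def\<close>)
qed

section \<open>The star graph of a family of cycles\<close>

definition verts :: "('e \<times> bool \<Rightarrow> 'v) \<Rightarrow> 'e set \<Rightarrow> 'v set" where
  "verts g C = g ` {d. fst d \<in> C}"

text \<open>The hypotheses restated for darts. Oddness of the cycles enters as
  \<open>cycle_size\<close>, 2-connectedness as an edge leaving \<open>A\<close> inside
  \<open>V - {v}\<close>, and connectedness of a cycle as propagation of a property along its
  darts.\<close>

locale cycle_family =
  fixes V :: "'v set" and E :: "'e set" and g :: "'e \<times> bool \<Rightarrow> 'v" and Cs :: "'e set set" and t :: nat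
  assumes finite_V: "finite V" and finite_E: "finite E"
    and ends_V: "fst d \<in> E \<Longrightarrow> g d \<in> V" and loopless: "fst d \<in> E \<Longrightarrow> g (flip d) \<noteq> g d"
    and degree: "v \<in> V \<Longrightarrow> dg g E v = 2 * t" and t_even: "even t" and t_ge: "2 \<le> t"
    and no_cut_vertex: "v \<in> V \<Longrightarrow> A \<subseteq> V - {v} \<Longrightarrow> A \<noteq> {} \<Longrightarrow> A \<noteq> V - {v} \<Longrightarrow>
      \<exists>d. fst d \<in> E \<and> g d \<in> A \<and> g (flip d) \<in> V - {v} - A"
    and cycle_edges: "C \<in> Cs \<Longrightarrow> C \<subseteq> E"
    and disjoint: "C \<in> Cs \<Longrightarrow> C' \<in> Cs \<Longrightarrow> e \<in> C \<Longrightarrow> e \<in> C' \<Longrightarrow> C = C'"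
    and cycle_degree: "C \<in> Cs \<Longrightarrow> v \<in> verts g C \<Longrightarrow> dg g C v = 2"
    and cycle_size: "C \<in> Cs \<Longrightarrow> 3 \<le> card (verts g C)"
    and cycle_connected: "C \<in> Cs \<Longrightarrow> a \<in> verts g C \<Longrightarrow> b \<in> verts g C \<Longrightarrow>
      (\<And>d. fst d \<in> C \<Longrightarrow> P (g d) \<Longrightarrow> P (g (flip d))) \<Longrightarrow> P a \<Longrightarrow> P b"
begin

lemma finite_Cs: "finite Cs"
  using cycle_edges finite_E by (metis PowI finite_Pow_iff finite_subset subsetI)

lemma in_verts: "fst d \<in> C \<Longrightarrow> g d \<in> verts g C"
  by (auto simp: verts_def)

lemma verts_V: "C \<in> Cs \<Longrightarrow> verts g C \<subseteq> V"
  using cycle_edges ends_V by (auto simp: verts_def)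

lemma finite_verts: "C \<in> Cs \<Longrightarrow> finite (verts g C)"
  using verts_V finite_V finite_subset by metis

lemma g_even: "even (dg g E v)"
proof (cases "v \<in> V")
  case False
  then have "{d. fst d \<in> E \<and> g d = v} = {}"
    using ends_V by blast
  then show ?thesis
    by (simp only: dg_def card.empty even_zero)
qed (simp add: degree)

text \<open>Inr C is the centre of the star replacing C, and the edge Inr (C, v) is its ray to v.\<close>

fun star :: "('e + 'e set \<times> 'v) \<times> bool \<Rightarrow> 'v + 'e set" where
  "star (Inl e, i) = Inl (g (e, i))"
| "star (Inr (C, v), i) = (if i then Inl v else Inr C)"

definition star_edges :: "('e + 'e set \<times> 'v) set" where
  "star_edges = Inl ` (E - \<Union>Cs) \<union> Inr ` (SIGMA C:Cs. verts g C)"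

lemma Inl_crossing:
  "Inl (fst d) \<in> crossing star F X \<longleftrightarrow> Inl (fst d) \<in> F \<and> (Inl (g d) \<in> X) \<noteq> (Inl (g (flip d)) \<in> X)"
  by (cases d; cases "snd d") (auto simp: crossing_def flip_def)

lemma Inr_crossing:
  "Inr (C, v) \<in> crossing star F X \<longleftrightarrow> Inr (C, v) \<in> F \<and> (Inl v \<in> X) \<noteq> (Inr C \<in> X)"
  by (auto simp: crossing_def)

text \<open>An original edge as bridge would be a bridge of the given graph, all of whose degrees
  are even. A ray from \<open>C\<close> to \<open>v\<close> as bridge would make \<open>v\<close> a
  cut vertex or leave \<open>v\<close> with no edges besides those of \<open>C\<close>.\<close>

lemma star_bridgeless: "bridgeless star star_edges"
  unfolding bridgeless_def
proof (intro allI notI)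
  fix X assume "card (crossing star star_edges X) = 1"
  then obtain x where x: "crossing star star_edges X = {x}"
    using card_1_singletonE by blast
  have same: "Inl v \<in> X \<longleftrightarrow> Inr C \<in> X" if "C \<in> Cs" "v \<in> verts g C" "x \<noteq> Inr (C, v)" for C v
    using Inr_crossing[of C v star_edges X] that unfolding x by (auto simp: star_edges_def)
  have other: "Inl (g d) \<in> X \<longleftrightarrow> Inl (g (flip d)) \<in> X" if "fst d \<in> E - \<Union>Cs" "x \<noteq> Inl (fst d)" for d
    using Inl_crossing[of d star_edges X] that unfolding x by (auto simp: star_edges_def)
  have "x \<in> star_edges"
    using x crossing_subset[of star star_edges X] by simp
  then consider e where "x = Inl e" "e \<in> E - \<Union>Cs"
    | C v where "x = Inr (C, v)" "C \<in> Cs" "v \<in> verts g C"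
    by (auto simp: star_edges_def)
  then show False
  proof cases
    case 1
    \<comment> \<open>Every star lies on one side here, so no edge of a cycle crosses.\<close>
    have "k = e" if k: "k \<in> crossing g E {v. Inl v \<in> X}" for k
    proof (rule ccontr)
      assume "k \<noteq> e"
      have kE: "k \<in> E" and kX: "Inl (g (k, True)) \<in> X \<longleftrightarrow> Inl (g (k, False)) \<notin> X"
        using k by (auto simp: crossing_def)
      show False
      proof (cases "k \<in> \<Union>Cs")
        case True
        then obtain C where C: "C \<in> Cs" "k \<in> C"
          by blast
        then show False
          using same[OF C(1), of "g (k, True)"] same[OF C(1), of "g (k, False)"] 1(1) kX in_verts[of "(k, _)" C]
          by simp
      next
        case False
        then show False
          using other[of "(k, True)"] kE kX 1(1) \<open>k \<noteq> e\<close> by (simp add: flip_def)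
      qed
    qed
    moreover have "e \<in> crossing g E {v. Inl v \<in> X}"
    proof -
      have "Inl (fst (e, True)) \<in> crossing star star_edges X"
        using x 1(1) by simp
      then have "(Inl (g (e, True)) \<in> X) \<noteq> (Inl (g (e, False)) \<in> X)"
        unfolding Inl_crossing by (simp add: flip_def)
      then show ?thesis
        using 1(2) by (simp add: crossing_def)
    qed
    ultimately have "crossing g E {v. Inl v \<in> X} = {e}"
      by blast
    then show False
      using bridgelessD[OF bridgeless_if_even[OF finite_E g_even]] by blast
  next
    case 2
    have vV: "v \<in> V"
      using 2 verts_V by blast
    have vC: "Inl v \<in> X \<longleftrightarrow> Inr C \<notin> X"
      using Inr_crossing[of C v star_edges X] x 2(1) by auto
    have sameC: "Inl (g d) \<in> X \<longleftrightarrow> Inl (g (flip d)) \<in> X"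
      if d: "fst d \<in> E" "fst d \<notin> C \<or> g d \<noteq> v \<and> g (flip d) \<noteq> v" for d
    proof (cases "fst d \<in> \<Union>Cs")
      case True
      then obtain C' where C': "C' \<in> Cs" "fst d \<in> C'"
        by blast
      then show ?thesis
        using same[OF C'(1) in_verts[OF C'(2)]] same[OF C'(1), of "g (flip d)"] in_verts[of "flip d" C'] 2(1) d(2)
        by auto
    next
      case False
      then show ?thesis
        using other[of d] d(1) 2(1) by simp
    qed
    \<comment> \<open>\<open>A\<close> is the side of \<open>v\<close> without \<open>v\<close>; the
      other vertices of \<open>C\<close> lie opposite. Edges across the cut belong to
      \<open>C\<close> and meet \<open>v\<close>, so nothing joins \<open>A\<close> to the rest of
      \<open>V - {v}\<close>.\<close>
    define A where "A = {w \<in> V - {v}. Inl w \<in> X \<longleftrightarrow> Inl v \<in> X}"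
    have "verts g C - {v} \<noteq> {}"
    proof
      assume "verts g C - {v} = {}"
      then have "card (verts g C) \<le> card {v}"
        by (intro card_mono) auto
      then show False
        using cycle_size[OF 2(2)] by simp
    qed
    then obtain w where w: "w \<in> verts g C" "w \<noteq> v"
      by blast
    have "w \<in> V - {v}" "w \<notin> A"
      using w same[OF 2(2) w(1)] 2(1,2) vC verts_V by (auto simp: A_def)
    then have "A \<noteq> V - {v}"
      by blast
    show False
    proof (cases "A = {}")
      case False
      then obtain d where d: "fst d \<in> E" "g d \<in> A" "g (flip d) \<in> V - {v} - A"
        using no_cut_vertex[OF vV _ False \<open>A \<noteq> V - {v}\<close>] A_def by blast
      then show False
        using sameC[OF d(1)] by (auto simp: A_def)
    next
      \<comment> \<open>With \<open>A\<close> empty, all neighbours of \<open>v\<close> lie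
        opposite, so all \<open>2 * t\<close> darts at \<open>v\<close> belong to \<open>C\<close>,
        which has only 2 there; \<open>t_ge\<close> excludes this.\<close>
      case True
      have "fst d \<in> C" if d: "fst d \<in> E" "g d = v" for d
      proof (rule ccontr)
        assume "fst d \<notin> C"
        then have "Inl (g (flip d)) \<in> X \<longleftrightarrow> Inl v \<in> X"
          using sameC[of d] d by simp
        moreover have "g (flip d) \<in> V"
          using ends_V[of "flip d"] d(1) by simp
        ultimately show False
          using True loopless[OF d(1)] d(2) by (auto simp: A_def)
      qed
      then have "{d. fst d \<in> E \<and> g d = v} \<subseteq> {d. fst d \<in> C \<and> g d = v}"
        by blast
      then have "dg g E v \<le> dg g C v"
        unfolding dg_def using finite_subset[OF cycle_edges[OF 2(2)] finite_E] by (intro card_mono) simp_all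
      then show False
        using degree[OF vV] t_ge cycle_degree[OF 2(2,3)] by simp
    qed
  qed
qed

end

section \<open>Detaching cycles along an even subgraph of the star graph\<close>

locale transitions = cycle_family V E g Cs t
  for V :: "'v set" and E :: "'e set" and g :: "'e \<times> bool \<Rightarrow> 'v" and Cs :: "'e set set" and t :: nat +
  fixes F :: "('e + 'e set \<times> 'v) set"
  assumes F_sub: "F \<subseteq> star_edges" and F_even: "\<And>v. even (dg star F v)"
    and F_cover: "\<And>v. 3 \<le> dg star star_edges v \<Longrightarrow> dg star F v \<noteq> 0"
begin

definition S :: "('e set \<times> 'v) set" where
  "S = {cv. Inr cv \<in> F}"

text \<open>Detaches from v the two edges of each cycle C with (C, v) in S.\<close>

definition detach :: "'e \<times> bool \<Rightarrow> 'v \<times> 'e set set" where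
  "detach d = (g d, {C\<in>Cs. fst d \<in> C \<and> (C, g d) \<in> S})"

lemma S_D: "(C, v) \<in> S \<Longrightarrow> C \<in> Cs \<and> v \<in> verts g C"
  using F_sub by (auto simp: S_def star_edges_def)

text \<open>The centre of \<open>C\<close> has one ray per vertex of \<open>C\<close>, hence degree
  at least 3, and is covered by \<open>F\<close>.\<close>

lemma S_nonempty:
  assumes "C \<in> Cs"
  shows "\<exists>v. (C, v) \<in> S"
proof -
  let ?I = "(\<lambda>v. (Inr (C, v) :: 'e + 'e set \<times> 'v, False)) ` verts g C"
  have "?I \<subseteq> {d. fst d \<in> star_edges \<and> star d = Inr C}"
    using assms by (auto simp: star_edges_def)
  moreover have "finite star_edges"
    using finite_E finite_Cs finite_verts by (auto simp: star_edges_def)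
  ultimately have "card ?I \<le> dg star star_edges (Inr C)"
    unfolding dg_def by (intro card_mono) simp_all
  moreover have "card ?I = card (verts g C)"
    by (intro card_image) (simp add: inj_on_def)
  ultimately have "dg star F (Inr C) \<noteq> 0"
    using cycle_size[OF assms] by (intro F_cover) simp
  then have "{d. fst d \<in> F \<and> star d = Inr C} \<noteq> {}"
    unfolding dg_def by (metis card.empty)
  then obtain d where d: "fst d \<in> F" "star d = Inr C"
    by blast
  obtain k i where ki: "d = (k, i)"
    by fastforce
  show ?thesis
  proof (cases k)
    case (Inr cv)
    then have "fst cv = C"
      using d(2) ki by (cases cv) (auto split: if_splits)
    then show ?thesis
      using d(1) ki Inr by (intro exI[of _ "snd cv"]) (auto simp: S_def)
  qed (use d ki in auto)
qed

lemma detach_cycle: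
  assumes "C \<in> Cs" "fst d \<in> C"
  shows "detach d = (g d, if (C, g d) \<in> S then {C} else {})"
  using assms disjoint by (auto simp: detach_def)

lemma detach_other: "fst d \<notin> \<Union>Cs \<Longrightarrow> detach d = (g d, {})"
  by (auto simp: detach_def)

text \<open>By edge-disjointness a dart is detached for at most one cycle: the vertex
  \<open>(v, {})\<close> is what remains of \<open>v\<close>, and \<open>(v, {C})\<close> carries
  the two darts of \<open>C\<close> split off there.\<close>

definition labels :: "'e set set set" where
  "labels = insert {} ((\<lambda>C. {C}) ` Cs)"

lemma finite_labels: "finite labels"
  using finite_Cs by (simp add: labels_def)

lemma detach_labels: "snd (detach d) \<in> labels"
proof (cases "fst d \<in> \<Union>Cs")
  case True
  then obtain C where C: "C \<in> Cs" "fst d \<in> C"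
    by blast
  then show ?thesis
    by (simp add: detach_cycle[OF C] labels_def)
qed (simp add: detach_other labels_def)

lemma sum_labels: "(\<Sum>y\<in>labels. f y) = (f {} :: nat) + (\<Sum>C\<in>Cs. f {C})"
  unfolding labels_def using finite_Cs by (subst sum.insert) (auto simp: sum.reindex inj_on_def)

lemma dg_detach_sum:
  assumes "finite R"
  shows "dg g R v = (\<Sum>y\<in>labels. dg detach R (v, y))"
proof -
  have "fst d \<in> R \<and> g d = v \<longleftrightarrow> fst d \<in> R \<and> (\<exists>y\<in>labels. detach d = (v, y))" for d
    using detach_labels[of d] by (auto simp: detach_def)
  then have "{d. fst d \<in> R \<and> g d = v} = (\<Union>y\<in>labels. {d. fst d \<in> R \<and> detach d = (v, y)})"
    by blast
  also have "card \<dots> = (\<Sum>y\<in>labels. dg detach R (v, y))"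
    unfolding dg_def using assms finite_labels by (intro card_UN_disjoint) auto
  finally show ?thesis
    by (simp add: dg_def)
qed

lemma detach_eq_single:
  assumes "C \<in> Cs"
  shows "detach d = (v, {C}) \<longleftrightarrow> (C, v) \<in> S \<and> fst d \<in> C \<and> g d = v"
proof (cases "fst d \<in> C")
  case True
  then show ?thesis
    by (auto simp: detach_cycle[OF assms True])
next
  case False
  then show ?thesis
    by (auto simp: detach_def)
qed

lemma dg_detach_single:
  assumes "C \<in> Cs"
  shows "dg detach E (v, {C}) = 2 * of_bool ((C, v) \<in> S)"
proof (cases "(C, v) \<in> S")
  case True
  have "{d. fst d \<in> E \<and> detach d = (v, {C})} = {d. fst d \<in> C \<and> g d = v}"
    using detach_eq_single[OF assms, of _ v] True cycle_edges[OF assms] by blast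
  then have "dg detach E (v, {C}) = dg g C v"
    by (simp only: dg_def)
  then show ?thesis
    using True cycle_degree[OF assms] S_D by simp
next
  case False
  then have "{d. fst d \<in> E \<and> detach d = (v, {C})} = {}"
    using detach_eq_single[OF assms, of _ v] by blast
  then have "dg detach E (v, {C}) = 0"
    by (simp only: dg_def card.empty)
  then show ?thesis
    using False by simp
qed

lemma dg_detach_empty:
  assumes "v \<in> V"
  shows "dg detach E (v, {}) + 2 * (\<Sum>C\<in>Cs. of_bool ((C, v) \<in> S)) = 2 * t"
  using dg_detach_sum[OF finite_E, of v] degree[OF assms] dg_detach_single
  by (simp add: sum_labels sum_distrib_left)

lemma even_dg_detach: "even (dg detach E x)"
proof (cases "fst x \<in> V \<and> snd x \<in> labels")
  case True
  obtain v y where x: "x = (v, y)"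
    by fastforce
  show ?thesis
  proof (cases "y = {}")
    case True
    then have "dg detach E x + 2 * (\<Sum>C\<in>Cs. of_bool ((C, v) \<in> S)) = 2 * t"
      using dg_detach_empty[of v] \<open>fst x \<in> V \<and> snd x \<in> labels\<close> x by simp
    then have "even (dg detach E x + 2 * (\<Sum>C\<in>Cs. of_bool ((C, v) \<in> S)))"
      by (simp only: dvd_triv_left)
    then show ?thesis
      by simp
  next
    case False
    then obtain C where "C \<in> Cs" "y = {C}"
      using True x by (auto simp: labels_def)
    then show ?thesis
      using dg_detach_single[of C v] x by simp
  qed
next
  case False
  have "g d \<in> V" if "fst d \<in> E" for d
    using ends_V that .
  then have "{d. fst d \<in> E \<and> detach d = x} = {}"
    using detach_labels False by (auto simp: detach_def)
  then show ?thesis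
    by (simp only: dg_def card.empty even_zero)
qed

text \<open>The degree sum over a closed set expresses its edge count, modulo 2, by the splits
  separated by that set; these are the crossing edges of \<open>F\<close> for a vertex set of the
  star graph.\<close>

lemma even_components_detach: "even_components detach E"
  unfolding even_components_def
proof (intro allI impI)
  fix X assume X: "crossing detach E X = {}"
  have closed: "detach d \<in> X \<longleftrightarrow> detach (flip d) \<in> X" if "fst d \<in> E" for d
    using that X crossing_iff_dart[of d detach E X] by auto
  define a b where "a v = ((v, {}) \<in> X)" and "b v C = ((v, {C}) \<in> X)" for v and C :: "'e set"
  define n where "n = card {e\<in>E. detach (e, True) \<in> X}"
  have "{e\<in>E. detach (e, True) \<in> X} = {e\<in>E. detach (e, True) \<in> X \<and> detach (e, False) \<in> X}"
    using closed[of "(e, True)" for e] by (auto simp: flip_def)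
  then have "2 * n = card {d. fst d \<in> E \<and> detach d \<in> X}"
    using darts_in_set[OF finite_E, of detach X] X by (simp add: n_def)
  also have "\<dots> = (\<Sum>x\<in>(V \<times> labels) \<inter> X. dg detach E x)"
    by (rule card_darts_into[OF finite_E])
      (use finite_V finite_labels ends_V detach_labels in \<open>auto simp: mem_Times_iff detach_def\<close>)
  also have "\<dots> = (\<Sum>x\<in>V \<times> labels. of_bool (x \<in> X) * dg detach E x)"
    using finite_V finite_labels by (auto simp: sum.inter_restrict intro!: sum.cong)
  also have "\<dots> = (\<Sum>v\<in>V. \<Sum>y\<in>labels. of_bool ((v, y) \<in> X) * dg detach E (v, y))"
    by (simp add: sum.cartesian_product)
  also have "\<dots> = (\<Sum>v\<in>V. of_bool (a v) * dg detach E (v, {})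
      + (\<Sum>C\<in>Cs. of_bool (b v C) * (2 * of_bool ((C, v) \<in> S))))"
    using dg_detach_single by (simp add: sum_labels a_def b_def)
  finally have n2: "2 * n = (\<Sum>v\<in>V. of_bool (a v) * dg detach E (v, {})
      + (\<Sum>C\<in>Cs. of_bool (b v C) * (2 * of_bool ((C, v) \<in> S))))" .
  \<comment> \<open>The degrees lost through splits are added on both sides, which avoids
    subtraction of natural numbers.\<close>
  have "2 * n + (\<Sum>v\<in>V. of_bool (a v) * (2 * (\<Sum>C\<in>Cs. of_bool ((C, v) \<in> S))))
    = (\<Sum>v\<in>V. of_bool (a v) * (2 * t)
      + (\<Sum>C\<in>Cs. of_bool (b v C) * (2 * of_bool ((C, v) \<in> S))))"
    unfolding n2 sum.distrib[symmetric]
  proof (rule sum.cong[OF refl])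
    fix v assume "v \<in> V"
    then have "of_bool (a v) * (2 * t) = of_bool (a v) * dg detach E (v, {})
        + of_bool (a v) * (2 * (\<Sum>C\<in>Cs. of_bool ((C, v) \<in> S)))"
      unfolding distrib_left[symmetric] by (simp only: dg_detach_empty)
    then show "of_bool (a v) * dg detach E (v, {}) + (\<Sum>C\<in>Cs. of_bool (b v C) * (2 * of_bool ((C, v) \<in> S)))
        + of_bool (a v) * (2 * (\<Sum>C\<in>Cs. of_bool ((C, v) \<in> S)))
      = of_bool (a v) * (2 * t) + (\<Sum>C\<in>Cs. of_bool (b v C) * (2 * of_bool ((C, v) \<in> S)))"
      by linarith
  qed
  then have "2 * (n + (\<Sum>v\<in>V. \<Sum>C\<in>Cs. of_bool (a v \<and> (C, v) \<in> S)))
    = 2 * ((\<Sum>v\<in>V. of_bool (a v) * t) + (\<Sum>v\<in>V. \<Sum>C\<in>Cs. of_bool (b v C \<and> (C, v) \<in> S)))"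
    by (simp add: sum_distrib_left sum.distrib of_bool_conj mult_ac)
  then have n: "n + (\<Sum>v\<in>V. \<Sum>C\<in>Cs. of_bool (a v \<and> (C, v) \<in> S))
    = (\<Sum>v\<in>V. of_bool (a v) * t) + (\<Sum>v\<in>V. \<Sum>C\<in>Cs. of_bool (b v C \<and> (C, v) \<in> S))"
    by (rule iffD1[OF mult_left_cancel, rotated]) simp
  \<comment> \<open>Modulo 2, the sum of two indicators is the indicator of their
    disagreement.\<close>
  have split: "(\<Sum>v\<in>V. \<Sum>C\<in>Cs. of_bool (a v \<and> (C, v) \<in> S)) + (\<Sum>v\<in>V. \<Sum>C\<in>Cs. of_bool (b v C \<and> (C, v) \<in> S))
    = (\<Sum>v\<in>V. \<Sum>C\<in>Cs. of_bool ((C, v) \<in> S \<and> a v \<noteq> b v C)) + 2 * (\<Sum>v\<in>V. \<Sum>C\<in>Cs. of_bool ((C, v) \<in> S \<and> a v \<and> b v C) :: nat)"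
    unfolding sum_distrib_left sum.distrib[symmetric] by (intro sum.cong refl) auto
  have "even (\<Sum>v\<in>V. \<Sum>C\<in>Cs. of_bool ((C, v) \<in> S \<and> a v \<noteq> b v C) :: nat)"
  proof -
    define Z :: "('v + 'e set) set" where "Z = Inl ` {v. a v} \<union> Inr ` {C\<in>Cs. \<exists>v. (C, v) \<in> S \<and> b v C}"
    \<comment> \<open>Detaching does not disconnect \<open>C\<close>. \<open>P u\<close> says that
      the copy of \<open>u\<close> through which \<open>C\<close> now passes lies in
      \<open>X\<close>, and this propagates along the cycle.\<close>
    have b_const: "b v C \<longleftrightarrow> b w C" if vw: "(C, v) \<in> S" "(C, w) \<in> S" for C v w
    proof -
      have C: "C \<in> Cs" "v \<in> verts g C" "w \<in> verts g C"
        using vw S_D by blast+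
      define P where "P u = ((u, if (C, u) \<in> S then {C} else {}) \<in> X)" for u
      have step: "P (g d) \<Longrightarrow> P (g (flip d))" if "fst d \<in> C" for d
        using closed[of d] detach_cycle[OF C(1), of d] detach_cycle[OF C(1), of "flip d"] that
          cycle_edges[OF C(1)] by (auto simp: P_def)
      have "P v = P w"
        using cycle_connected[OF C(1,2,3), of P] cycle_connected[OF C(1,3,2), of P] step by blast
      then show ?thesis
        using vw by (simp add: P_def b_def)
    qed
    have ZL: "Inl v \<in> Z \<longleftrightarrow> a v" for v
      by (auto simp: Z_def)
    have ZR: "Inr C \<in> Z \<longleftrightarrow> b v C" if CvS: "(C, v) \<in> S" for C v
    proof -
      have "Inr C \<in> Z \<longleftrightarrow> C \<in> Cs \<and> (\<exists>w. (C, w) \<in> S \<and> b w C)"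
        by (auto simp: Z_def)
      then show ?thesis
        using b_const[OF CvS] S_D[OF CvS] CvS by metis
    qed
    have "crossing star F Z = Inr ` {(C, v) \<in> S. a v \<noteq> b v C}"
    proof (intro set_eqI iffI)
      fix k :: "'e + 'e set \<times> 'v" assume k: "k \<in> crossing star F Z"
      show "k \<in> Inr ` {(C, v) \<in> S. a v \<noteq> b v C}"
      proof (cases k)
        case (Inl e)
        have "Inl e \<in> F"
          using k Inl crossing_subset[of star F Z] by blast
        then have e: "e \<in> E - \<Union>Cs"
          using F_sub by (auto simp: star_edges_def)
        \<comment> \<open>An edge outside all cycles keeps its ends at undetached vertices, so
          closedness of \<open>X\<close> prevents it from crossing; only rays remain.\<close>
        have "a (g (e, True)) \<longleftrightarrow> a (g (e, False))"
          using closed[of "(e, True)"] e detach_other[of "(e, True)"] detach_other[of "(e, False)"]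
          by (simp add: a_def flip_def)
        then have "k \<notin> crossing star F Z"
          using Inl Inl_crossing[of "(e, True)" F Z] by (simp add: ZL flip_def)
        then show ?thesis
          using k by blast
      next
        case (Inr cv)
        obtain C v where cv: "cv = (C, v)"
          by fastforce
        have kF: "Inr (C, v) \<in> F" "(Inl v \<in> Z) \<noteq> (Inr C \<in> Z)"
          using k Inr cv Inr_crossing[of C v F Z] by auto
        then have CvS: "(C, v) \<in> S"
          by (simp add: S_def)
        have "a v \<noteq> b v C"
          using kF(2) ZL[of v] ZR[OF CvS] by blast
        then show ?thesis
          using Inr cv CvS by auto
      qed
    next
      fix k :: "'e + 'e set \<times> 'v" assume "k \<in> Inr ` {(C, v) \<in> S. a v \<noteq> b v C}"
      then obtain C v where Cv: "k = Inr (C, v)" "(C, v) \<in> S" "a v \<noteq> b v C"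
        by auto
      then have "(Inl v \<in> Z) \<noteq> (Inr C \<in> Z)"
        using ZL[of v] ZR[OF Cv(2)] by blast
      then show "k \<in> crossing star F Z"
        using Cv Inr_crossing[of C v F Z] by (simp add: S_def)
    qed
    moreover have "finite F"
      using F_sub finite_E finite_Cs finite_verts by (auto simp: star_edges_def intro: finite_subset)
    ultimately have "even (card (Inr ` {(C, v) \<in> S. a v \<noteq> b v C} :: ('e + 'e set \<times> 'v) set))"
      using even_crossing[of F star Z] F_even by simp
    then have "even (card {(C, v) \<in> S. a v \<noteq> b v C})"
      by (simp add: card_image)
    moreover have "{(C, v) \<in> S. a v \<noteq> b v C} = {(C, v) \<in> Cs \<times> V. (C, v) \<in> S \<and> a v \<noteq> b v C}"
      using S_D verts_V by blast
    moreover have "card {(C, v) \<in> Cs \<times> V. (C, v) \<in> S \<and> a v \<noteq> b v C}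
      = (\<Sum>(C, v)\<in>Cs \<times> V. of_bool ((C, v) \<in> S \<and> a v \<noteq> b v C))"
      using finite_Cs finite_V by (simp add: sum.If_cases of_bool_def Int_def case_prod_unfold mem_Times_iff conj_assoc)
    ultimately show ?thesis
      by (simp add: sum.cartesian_product[symmetric] sum.swap[of _ V Cs])
  qed
  moreover have "even (\<Sum>v\<in>V. of_bool (a v) * t)"
    using t_even by (intro dvd_sum) simp
  ultimately have "even n"
    using n split by presburger
  then show "even (card {e\<in>E. detach (e, True) \<in> X})"
    by (simp add: n_def)
qed

text \<open>Balance at all copies of \<open>v\<close> adds up to degree \<open>t\<close>. A split
  vertex \<open>(v, {C})\<close> has degree 2, so one of its edges of \<open>C\<close> lies in
  \<open>R\<close> and the other does not.\<close>

lemma balanced_factor: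
  obtains R where "R \<subseteq> E" "\<And>v. v \<in> V \<Longrightarrow> dg g R v = t"
    "\<And>C. C \<in> Cs \<Longrightarrow> C \<inter> R \<noteq> {} \<and> C \<inter> (E - R) \<noteq> {}"
proof -
  obtain R where R: "R \<subseteq> E" "\<And>x. 2 * dg detach R x = dg detach E x"
    using even_components_balanced_half[OF finite_E even_dg_detach even_components_detach] by metis
  have finR: "finite R"
    using finite_subset[OF R(1) finite_E] .
  have "dg g R v = t" if "v \<in> V" for v
  proof -
    have "2 * dg g R v = dg g E v"
      unfolding dg_detach_sum[OF finR] dg_detach_sum[OF finite_E] sum_distrib_left R(2) ..
    then show ?thesis
      using degree[OF that] by simp
  qed
  moreover have "C \<inter> R \<noteq> {} \<and> C \<inter> (E - R) \<noteq> {}" if C: "C \<in> Cs" for C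
  proof -
    obtain v where v: "(C, v) \<in> S"
      using S_nonempty[OF C] by blast
    have E2: "dg detach E (v, {C}) = 2"
      using dg_detach_single[OF C, of v] v by simp
    then have R1: "dg detach R (v, {C}) = 1"
      using R(2)[of "(v, {C})"] by simp
    then have "{d. fst d \<in> R \<and> detach d = (v, {C})} \<noteq> {}"
      unfolding dg_def by (metis card.empty zero_neq_one)
    then obtain d where d: "fst d \<in> R" "detach d = (v, {C})"
      by blast
    have "\<not> {d. fst d \<in> E \<and> detach d = (v, {C})} \<subseteq> {d. fst d \<in> R \<and> detach d = (v, {C})}"
    proof
      assume "{d. fst d \<in> E \<and> detach d = (v, {C})} \<subseteq> {d. fst d \<in> R \<and> detach d = (v, {C})}"
      then have "dg detach E (v, {C}) \<le> dg detach R (v, {C})"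
        unfolding dg_def using finR by (intro card_mono) simp_all
      then show False
        using E2 R1 by simp
    qed
    then obtain d' where d': "fst d' \<in> E - R" "detach d' = (v, {C})"
      by blast
    then show ?thesis
      using d detach_eq_single[OF C] by blast
  qed
  ultimately show thesis
    using that R(1) by blast
qed

end

lemma (in cycle_family) cycle_family_factor:
  obtains R where "R \<subseteq> E" "\<And>v. v \<in> V \<Longrightarrow> dg g R v = t"
    "\<And>C. C \<in> Cs \<Longrightarrow> C \<inter> R \<noteq> {} \<and> C \<inter> (E - R) \<noteq> {}"
proof -
  have "finite star_edges"
    using finite_E finite_Cs finite_verts by (auto simp: star_edges_def)
  then obtain F where F: "F \<subseteq> star_edges" "\<And>v. even (dg star F v)"
    "\<And>v. 3 \<le> dg star star_edges v \<Longrightarrow> dg star F v \<noteq> 0"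
    using bridgeless_even_cover[OF _ star_bridgeless] by metis
  interpret transitions V E g Cs t F
    by unfold_locales (use F in auto)
  show thesis
    using balanced_factor that by metis
qed

section \<open>From endpoint sets to darts, and the theorem\<close>

lemma multigraph_darts:
  assumes "multigraph V E ends"
  obtains g :: "'e \<times> bool \<Rightarrow> 'v" where
    "\<And>d. fst d \<in> E \<Longrightarrow> ends (fst d) = {g d, g (flip d)}" "\<And>d. fst d \<in> E \<Longrightarrow> g (flip d) \<noteq> g d"
proof -
  have "\<forall>e\<in>E. \<exists>x y. ends e = {x, y} \<and> x \<noteq> y"
    using assms by (auto simp: multigraph_def card_2_iff)
  then obtain x y where "\<And>e. e \<in> E \<Longrightarrow> ends e = {x e, y e} \<and> x e \<noteq> y e"
    by metis
  then have xy: "\<And>e. e \<in> E \<Longrightarrow> ends e = {x e, y e}" "\<And>e. e \<in> E \<Longrightarrow> x e \<noteq> y e" "\<And>e. e \<in> E \<Longrightarrow> y e \<noteq> x e"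
    by metis+
  show thesis
    by (rule that[of "\<lambda>d. if snd d then x (fst d) else y (fst d)"])
      (use xy in \<open>auto simp: flip_def\<close>)
qed

theorem theorem5:
  fixes V :: "'v set" and E :: "'e set" and ends :: "'e \<Rightarrow> 'v set"
    and t :: nat and Cs :: "'e set set"
  assumes "multigraph V E ends"
    and "even t" and "t \<ge> 2"
    and "two_connected V E ends"
    and "\<forall>v\<in>V. deg ends E v = 2 * t"
    and "\<forall>C\<in>Cs. is_cycle E ends C \<and> odd (card C)"
    and "\<forall>C1\<in>Cs. \<forall>C2\<in>Cs. C1 \<noteq> C2 \<longrightarrow> C1 \<inter> C2 = {}"
  shows "\<exists>F. t_factor t V E ends F \<and>
           (\<forall>C\<in>Cs. C \<inter> F \<noteq> {} \<and> C \<inter> (E - F) \<noteq> {})"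
proof -
  obtain g :: "'e \<times> bool \<Rightarrow> 'v" where
    g: "\<And>d. fst d \<in> E \<Longrightarrow> ends (fst d) = {g d, g (flip d)}" "\<And>d. fst d \<in> E \<Longrightarrow> g (flip d) \<noteq> g d"
    by (rule multigraph_darts[OF assms(1)]) (rule that)
  have fin: "finite V" "finite E" and ends_V: "\<And>e. e \<in> E \<Longrightarrow> ends e \<subseteq> V"
    using assms(1) by (auto simp: multigraph_def)
  have dg_deg: "dg g D v = deg ends D v" if "D \<subseteq> E" for D v
  proof -
    have "finite D"
      using finite_subset[OF that fin(2)] .
    have "of_bool (g (e, True) = v) + of_bool (g (e, False) = v) = (of_bool (v \<in> ends e) :: nat)"
      if "e \<in> D" for e
    proof -
      have "ends e = {g (e, True), g (e, False)}" "g (e, False) \<noteq> g (e, True)"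
        using g[of "(e, True)"] subsetD[OF \<open>D \<subseteq> E\<close> that] by (simp_all add: flip_def)
      then show ?thesis
        by simp
    qed
    then have "dg g D v = (\<Sum>e\<in>D. of_bool (v \<in> ends e))"
      unfolding dg_sum[OF \<open>finite D\<close>] by (intro sum.cong refl)
    also have "\<dots> = deg ends D v"
      using \<open>finite D\<close> by (simp add: deg_def sum.If_cases of_bool_def Int_def)
    finally show ?thesis .
  qed
  have dart: "\<exists>d. fst d = e \<and> g d = x \<and> g (flip d) = y" if e: "e \<in> E" "ends e = {x, y}" for e x y
  proof -
    have "{x, y} = {g (e, True), g (e, False)}"
      using g(1)[of "(e, True)"] e by (simp add: flip_def)
    then consider "x = g (e, True)" "y = g (e, False)" | "x = g (e, False)" "y = g (e, True)"
      unfolding doubleton_eq_iff by blast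
    then show ?thesis
    proof cases
      case 1
      then show ?thesis
        by (intro exI[of _ "(e, True)"]) (simp add: flip_def)
    next
      case 2
      then show ?thesis
        by (intro exI[of _ "(e, False)"]) (simp add: flip_def)
    qed
  qed
  have verts: "verts g C = \<Union>(ends ` C)" if "C \<subseteq> E" for C
  proof (intro set_eqI iffI)
    fix v assume "v \<in> verts g C"
    then obtain d where "fst d \<in> C" "v = g d"
      by (auto simp: verts_def)
    then show "v \<in> \<Union>(ends ` C)"
      using g(1)[of d] that by blast
  next
    fix v assume "v \<in> \<Union>(ends ` C)"
    then obtain e where e: "e \<in> C" "v \<in> ends e"
      by blast
    then have "v = g (e, True) \<or> v = g (e, False)"
      using g(1)[of "(e, True)"] that by (auto simp: flip_def)
    then show "v \<in> verts g C"
      using e(1) by (auto simp: verts_def)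
  qed
  have cyc: "C \<subseteq> E" "C \<noteq> {}" "\<And>v. v \<in> verts g C \<Longrightarrow> dg g C v = 2"
    "connected_sg ends (verts g C) C" "odd (card C)" if "C \<in> Cs" for C
    using assms(6) that verts[of C] dg_deg[of C] by (auto simp: is_cycle_def)
  interpret cycle_family V E g Cs t
  proof
    show "finite V" "finite E" "even t" "2 \<le> t"
      using fin assms(2,3) .
    show "g d \<in> V" if "fst d \<in> E" for d
      using g(1)[OF that] ends_V[OF that] by blast
    show "g (flip d) \<noteq> g d" if "fst d \<in> E" for d
      using g(2)[OF that] .
    show "dg g E v = 2 * t" if "v \<in> V" for v
      using assms(5) dg_deg[of E v] that by simp
    show "\<exists>d. fst d \<in> E \<and> g d \<in> A \<and> g (flip d) \<in> V - {v} - A"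
      if v: "v \<in> V" and A: "A \<subseteq> V - {v}" "A \<noteq> {}" "A \<noteq> V - {v}" for v A
    proof (rule ccontr)
      assume none: "\<not> ?thesis"
      obtain a b where ab: "a \<in> A" "b \<in> V - {v} - A"
        using A by blast
      have con: "connected_sg ends (V - {v}) {e\<in>E. v \<notin> ends e}"
        using assms(4) v ab unfolding two_connected_def by blast
      have "b \<in> A"
      proof (rule connected_sg_invariant[where P = "\<lambda>x. x \<in> A", OF con, of a])
        fix e x y assume e: "e \<in> {e\<in>E. v \<notin> ends e}" "ends e = {x, y}" "y \<in> V - {v}" "x \<in> A"
        then obtain d where "fst d = e" "g d = x" "g (flip d) = y"
          using dart[of e x y] by blast
        then show "y \<in> A"
          using none e by blast
      qed (use ab A in auto)
      then show False
        using ab by blast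
    qed
    show "C \<subseteq> E" if "C \<in> Cs" for C
      using cyc(1)[OF that] .
    show "C = C'" if "C \<in> Cs" "C' \<in> Cs" "e \<in> C" "e \<in> C'" for C C' e
      using assms(7) that by blast
    show "dg g C v = 2" if "C \<in> Cs" "v \<in> verts g C" for C v
      using cyc(3)[OF that] .
    show "3 \<le> card (verts g C)" if C: "C \<in> Cs" for C
    proof -
      have finC: "finite C"
        using finite_subset[OF cyc(1)[OF C] fin(2)] .
      then have finW: "finite (verts g C)"
        by (simp add: verts_def)
      \<comment> \<open>Counting darts shows that \<open>C\<close> has as many vertices as edges, an
        odd number; without loops it is not 1.\<close>
      have "2 * card C = card {d. fst d \<in> C \<and> g d \<in> UNIV}"
        using card_darts[OF finC, of "\<lambda>_. True"] by simp
      also have "\<dots> = (\<Sum>v\<in>verts g C \<inter> UNIV. dg g C v)"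
        by (rule card_darts_into[OF finC finW]) (simp add: verts_def)
      also have "\<dots> = 2 * card (verts g C)"
        using cyc(3)[OF C] by simp
      finally have "odd (card (verts g C))"
        using cyc(5)[OF C] by simp
      moreover have "card (verts g C) \<noteq> 1"
      proof
        assume "card (verts g C) = 1"
        then obtain w where w: "verts g C = {w}"
          using card_1_singletonE by blast
        obtain e where "e \<in> C"
          using cyc(2)[OF C] by blast
        then have "g (e, True) \<in> {w}" "g (e, False) \<in> {w}"
          unfolding w[symmetric] by (auto simp: verts_def)
        then show False
          using g(2)[of "(e, True)"] \<open>e \<in> C\<close> cyc(1)[OF C] by (auto simp: flip_def)
      qed
      ultimately show ?thesis
        by (elim oddE) simp
    qed
    show "P b" if C: "C \<in> Cs" and ab: "a \<in> verts g C" "b \<in> verts g C"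
      and step: "\<And>d. fst d \<in> C \<Longrightarrow> P (g d) \<Longrightarrow> P (g (flip d))" and "P a" for C a b P
    proof (rule connected_sg_invariant[where P = P, OF cyc(4)[OF C] ab \<open>P a\<close>])
      fix e x y assume e: "e \<in> C" "ends e = {x, y}" "P x"
      then obtain d where "fst d = e" "g d = x" "g (flip d) = y"
        using dart[of e x y] cyc(1)[OF C] by blast
      then show "P y"
        using step[of d] e by simp
    qed
  qed
  obtain R where R: "R \<subseteq> E" "\<And>v. v \<in> V \<Longrightarrow> dg g R v = t"
    "\<And>C. C \<in> Cs \<Longrightarrow> C \<inter> R \<noteq> {} \<and> C \<inter> (E - R) \<noteq> {}"
    using cycle_family_factor by metis
  then have "t_factor t V E ends R"
    using dg_deg[OF R(1)] by (simp add: t_factor_def)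
  then show ?thesis
    using R(3) by blast
qed

end
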